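(* An elliptic curve $E/\mathbf{Q}$ has two pairs of Galois-stable cyclic subgroups of order $4$ if and only if $E/\mathbf{Q}$ has exactly one model of the form $$y^2=x(x-r)\Big(x-r\Big(\frac{1-\tau^2}{1+\tau^2}\Big)^2\Big)$$ with $r$ a squarefree positive integer and $\tau\in\mathbf{Q}$ with $0<\tau<1$.
   Context: A cyclic subgroup of order $4$ of $E(\overline{\mathbf{Q}})$ is Galois-stable if it is mapped to itself by every element of $\mathrm{Gal}(\overline{\mathbf{Q}}/\mathbf{Q})$. A pair of Galois-stable cyclic subgroups of order $4$ is a set of two distinct Galois-stable cyclic subgroups of order $4$ of $E$ that intersect in the same subgroup of order $2$ (each subgroup in the pair is itself Galois-stable). A model of $E/\mathbf{Q}$ is a Weierstrass equation over $\mathbf{Q}$ defining an elliptic curve isomorphic to $E$ over $\mathbf{Q}$; "exactly one model of the form" means that exactly one pair $(r,\tau)$ of the stated type gives a model of $E$. *)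

theory Defs
  imports
    "HOL-Algebra.Algebraic_Closure_Type"
    "HOL-Algebra.Generated_Groups"
    "HOL-Computational_Algebra.Squarefree"
begin

section \<open>Weierstrass equations\<close>

text \<open>
  \<open>Weierstrass a1 a2 a3 a4 a6\<close> is the equation
  $y^2 + a_1 xy + a_3 y = x^3 + a_2 x^2 + a_4 x + a_6$.
\<close>

datatype 'a weierstrass = Weierstrass 'a 'a 'a 'a 'a

fun weierstrass_eval :: "'a::field weierstrass \<Rightarrow> 'a \<Rightarrow> 'a \<Rightarrow> 'a" where
  "weierstrass_eval (Weierstrass a1 a2 a3 a4 a6) x y =
     y^2 + a1 * x * y + a3 * y - (x^3 + a2 * x^2 + a4 * x + a6)"

fun discriminant :: "'a::field weierstrass \<Rightarrow> 'a" where
  "discriminant (Weierstrass a1 a2 a3 a4 a6) =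
     (let b2 = a1^2 + 4 * a2;
          b4 = 2 * a4 + a1 * a3;
          b6 = a3^2 + 4 * a6;
          b8 = a1^2 * a6 + 4 * a2 * a6 - a1 * a3 * a4 + a2 * a3^2 - a4^2
      in - (b2^2 * b8) - 8 * b4^3 - 27 * b6^2 + 9 * b2 * b4 * b6)"

definition elliptic_curve :: "'a::field weierstrass \<Rightarrow> bool" where
  "elliptic_curve W \<longleftrightarrow> discriminant W \<noteq> 0"

text \<open>
  Isomorphism over \<open>\<rat>\<close>: an admissible change of variables
  $x = u^2 x' + r$, $y = u^3 y' + u^2 s x' + t$ with $u \neq 0$ turns the first
  equation into the second, up to the factor $u^6$. Both sides are polynomials
  in $x'$ and $y'$ over the infinite field \<open>\<rat>\<close>, so agreement at all rational
  values is equality of polynomials.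
\<close>

definition isomorphic_over_rat :: "rat weierstrass \<Rightarrow> rat weierstrass \<Rightarrow> bool" where
  "isomorphic_over_rat W W' \<longleftrightarrow>
     (\<exists>u r s t. u \<noteq> 0 \<and>
        (\<forall>x y. weierstrass_eval W (u^2 * x + r) (u^3 * y + u^2 * s * x + t)
               = u^6 * weierstrass_eval W' x y))"

definition is_model :: "rat weierstrass \<Rightarrow> rat weierstrass \<Rightarrow> bool" where
  "is_model W E \<longleftrightarrow> elliptic_curve W \<and> isomorphic_over_rat E W"


section \<open>The group of points\<close>

datatype 'a point = Infinity | Affine 'a 'a

fun on_curve :: "'a::field weierstrass \<Rightarrow> 'a point \<Rightarrow> bool" where
  "on_curve W Infinity \<longleftrightarrow> True"
| "on_curve W (Affine x y) \<longleftrightarrow> weierstrass_eval W x y = 0"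

text \<open>
  Chord-and-tangent law; \<open>l\<close> and \<open>n\<close> are the slope and intercept of the line
  $y = l x + n$ through the two points (the tangent if they coincide). Two points
  on the curve with the same $x$-coordinate are equal or opposite.
\<close>

fun point_add :: "'a::field weierstrass \<Rightarrow> 'a point \<Rightarrow> 'a point \<Rightarrow> 'a point" where
  "point_add W Infinity Q = Q"
| "point_add W P Infinity = P"
| "point_add (Weierstrass a1 a2 a3 a4 a6) (Affine x1 y1) (Affine x2 y2) =
     (if x1 = x2 \<and> y1 + y2 + a1 * x2 + a3 = 0 then Infinity
      else
        let l = (if x1 = x2
                 then (3 * x1^2 + 2 * a2 * x1 + a4 - a1 * y1) / (2 * y1 + a1 * x1 + a3)
                 else (y2 - y1) / (x2 - x1));
            n = y1 - l * x1;
            x3 = l^2 + a1 * l - a2 - x1 - x2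
        in Affine x3 (- ((l + a1) * x3) - n - a3))"

definition point_group :: "'a::field weierstrass \<Rightarrow> 'a point monoid" where
  "point_group W = \<lparr>carrier = {P. on_curve W P}, monoid.mult = point_add W, one = Infinity\<rparr>"

definition geometric_points :: "rat weierstrass \<Rightarrow> rat alg_closure point monoid" where
  "geometric_points E = point_group (map_weierstrass to_ac E)"


section \<open>Galois-stable cyclic subgroups of order 4\<close>

definition galois_group :: "(rat alg_closure \<Rightarrow> rat alg_closure) set" where
  "galois_group = {\<sigma>. bij \<sigma> \<and>
     (\<forall>x y. \<sigma> (x + y) = \<sigma> x + \<sigma> y) \<and>
     (\<forall>x y. \<sigma> (x * y) = \<sigma> x * \<sigma> y) \<and>
     (\<forall>q. \<sigma> (to_ac q) = to_ac q)}"

definition galois_stable :: "rat alg_closure point set \<Rightarrow> bool" where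
  "galois_stable C \<longleftrightarrow> (\<forall>\<sigma>\<in>galois_group. map_point \<sigma> ` C = C)"

definition cyclic_subgroup_of_order :: "nat \<Rightarrow> 'a set \<Rightarrow> 'a monoid \<Rightarrow> bool" where
  "cyclic_subgroup_of_order n C G \<longleftrightarrow>
     (\<exists>P\<in>carrier G. C = generate G {P}) \<and> card C = n"

definition stable_cyclic4 :: "rat weierstrass \<Rightarrow> rat alg_closure point set \<Rightarrow> bool" where
  "stable_cyclic4 E C \<longleftrightarrow>
     cyclic_subgroup_of_order 4 C (geometric_points E) \<and> galois_stable C"

definition stable_cyclic4_pairs :: "rat weierstrass \<Rightarrow> rat alg_closure point set set set" where
  "stable_cyclic4_pairs E =
     {{C, D} | C D. stable_cyclic4 E C \<and> stable_cyclic4 E D \<and> C \<noteq> D \<and> card (C \<inter> D) = 2}"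


section \<open>The family of models\<close>

text \<open>
  The equation $y^2 = x(x-r)(x-rc^2)$ with $c = (1-\tau^2)/(1+\tau^2)$,
  with the right-hand side expanded.
\<close>

definition model_curve :: "int \<Rightarrow> rat \<Rightarrow> rat weierstrass" where
  "model_curve r \<tau> =
     (let e = of_int r * ((1 - \<tau>^2) / (1 + \<tau>^2))^2
      in Weierstrass 0 (- (of_int r + e)) 0 (of_int r * e) 0)"

lemma model_curve_equation:
  "weierstrass_eval (model_curve r \<tau>) x y = 0 \<longleftrightarrow>
     y^2 = x * (x - of_int r) * (x - of_int r * ((1 - \<tau>^2) / (1 + \<tau>^2))^2)"
proof -
  have "weierstrass_eval (Weierstrass 0 (- (a + e)) 0 (a * e) 0) x y
          = y^2 - x * (x - a) * (x - e)" for a e :: rat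
    by (simp add: algebra_simps power2_eq_square power3_eq_cube)
  then show ?thesis
    by (simp add: model_curve_def Let_def del: weierstrass_eval.simps)
qed

end

theory Submission
  imports Defs
begin

text \<open>
  Completing the square turns a Weierstrass equation into
  $\eta^2 = g(x)$ with $\eta = 2y + a_1 x + a_3$ and
  $g(x) = 4x^3 + b_2 x^2 + 2 b_4 x + b_6$. Negation is $\eta \mapsto -\eta$, so the points of
  order 2 are the $(e, f)$ with $\eta = 0$ and $g(e) = 0$. For such a point $T$ the equation
  $2P = T$ says exactly that $(x(P) - e)^2 = g'(e)/4$
  (\<open>double_eq_two_torsion\<close>, \<open>double_at_half\<close>). Over an algebraically closed field the cyclic
  groups of order 4 above $T$ therefore correspond to the square roots of $g'(e)/4$, and such a
  group consists of the point at infinity and all points whose $x$-coordinate is $e$ or $x(P)$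
  (\<open>cyclic_subgroup_of_order_4_iff\<close>).

  An automorphism of $\overline{\mathbf{Q}}$ preserves this group iff it fixes $e$ and $x(P)$,
  because it preserves the zero set of $g$, which contains $e$ but not $x(P)$. Since
  every irrational algebraic number is moved by some automorphism
  (\<open>fixed_by_galois_group_iff\<close>), the group is Galois-stable iff $e$ and $x(P)$ are rational
  (\<open>galois_stable_halving_subgroup_iff\<close>). So above a rational $T$ there is one
  pair of stable groups if $g'(e)/4$ is a square in $\mathbf{Q}$ and none otherwise, and
  counting pairs means counting the rational roots $e$ of $g$ for which $g'(e)/4$ is a square
  (\<open>card_stable_cyclic4_pairs\<close>).

  If there are two such roots, the third root of $g$ is rational as well. For roots
  $e_1 < e_2 < e_3$ the value $g'(e_i)/4$ is the product of the two differences
  $e_i - e_j$; it is negative at $e_2$, so the two roots are $e_1$ and $e_3$. Both values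
  are squares iff $c^2 = (e_2 - e_1)/(e_3 - e_1)$ and $d^2 = (e_3 - e_2)/(e_3 - e_1)$ have rational
  solutions. These satisfy $c^2 + d^2 = 1$, and the rational points of the circle are
  parametrised by $c = (1 - \tau^2)/(1 + \tau^2)$. Writing $e_3 - e_1 = u^2 r$ with $r$ squarefree
  gives the model (\<open>model_exists\<close>).

  Conversely a model exhibits such roots (\<open>card_square_two_torsion_of_model\<close>). Two models of the
  same curve always coincide (\<open>model_unique\<close>): a change of variables acts on $x$ by an
  increasing affine map $x \mapsto u^2 x + s$, hence it respects the order of the roots; then $r$
  is the squarefree class of $e_3 - e_1$, and $\tau$ is determined by the ratio $c^2$.
\<close>

section \<open>Automorphisms of an algebraic closure\<close>

text \<open>
  The graph of a homomorphism over the base field from a subring of the algebraic closure into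
  the closure. Working with graphs instead of partial functions makes unions of chains trivial;
  single-valuedness and injectivity are both consequences of the last clause, since every subring
  that contains the base field is a field.
\<close>
definition field_graph :: "('a::field alg_closure \<times> 'a alg_closure) set \<Rightarrow> bool" where
  "field_graph G \<longleftrightarrow>
     (\<forall>q. (to_ac q, to_ac q) \<in> G) \<and>
     (\<forall>a b c d. (a, b) \<in> G \<longrightarrow> (c, d) \<in> G \<longrightarrow> (a + c, b + d) \<in> G \<and> (a * c, b * d) \<in> G) \<and>
     (\<forall>b. (0, b) \<in> G \<longrightarrow> b = 0)"

text \<open>
  If \<open>G\<close> is the graph of a homomorphism, these are the pairs of a polynomial over its domain and
  the image of that polynomial under the homomorphism.
\<close>
definition poly_pairs :: "('a::field \<times> 'a) set \<Rightarrow> ('a poly \<times> 'a poly) set" where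
  "poly_pairs G = {(p, q). \<forall>i. (poly.coeff p i, poly.coeff q i) \<in> G}"

text \<open>
  Up to a constant factor, \<open>m\<close> is the minimal polynomial of \<open>a\<close> over the domain of \<open>G\<close> and \<open>m'\<close>
  is its image.
\<close>
definition minimal_pair ::
  "('a::field \<times> 'a) set \<Rightarrow> 'a \<Rightarrow> 'a poly \<Rightarrow> 'a poly \<Rightarrow> bool" where
  "minimal_pair G a m m' \<longleftrightarrow> (m, m') \<in> poly_pairs G \<and> m \<noteq> 0 \<and> poly m a = 0 \<and>
     (\<forall>p q. (p, q) \<in> poly_pairs G \<longrightarrow> p \<noteq> 0 \<longrightarrow> poly p a = 0 \<longrightarrow>
        Polynomial.degree m \<le> Polynomial.degree p)"

lemma field_graph_base: "field_graph G \<Longrightarrow> (to_ac q, to_ac q) \<in> G"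
  and field_graph_add: "field_graph G \<Longrightarrow> (a, b) \<in> G \<Longrightarrow> (c, d) \<in> G \<Longrightarrow> (a + c, b + d) \<in> G"
  and field_graph_mult: "field_graph G \<Longrightarrow> (a, b) \<in> G \<Longrightarrow> (c, d) \<in> G \<Longrightarrow> (a * c, b * d) \<in> G"
  and field_graph_0D: "field_graph G \<Longrightarrow> (0, b) \<in> G \<Longrightarrow> b = 0"
  by (simp_all add: field_graph_def)

lemma field_graph_0: "field_graph G \<Longrightarrow> (0, 0) \<in> G"
  and field_graph_1: "field_graph G \<Longrightarrow> (1, 1) \<in> G"
  using field_graph_base[of G 0] field_graph_base[of G 1] by simp_all

lemma field_graph_diff:
  assumes "field_graph G" "(a, b) \<in> G" "(c, d) \<in> G" shows "(a - c, b - d) \<in> G"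
  using field_graph_add[OF assms(1,2) field_graph_mult[OF assms(1) field_graph_base[OF assms(1), of "-1"] assms(3)]]
  by simp

lemma field_graph_sum:
  assumes "field_graph G" "\<And>i. i \<in> A \<Longrightarrow> (f i, g i) \<in> G" shows "(sum f A, sum g A) \<in> G"
  using assms(2)
  by (induction A rule: infinite_finite_induct)
     (auto intro: field_graph_0[OF assms(1)] field_graph_add[OF assms(1)])

lemma field_graph_poly:
  assumes "field_graph G" "(a, b) \<in> G"
  shows "(poly (map_poly to_ac r) a, poly (map_poly to_ac r) b) \<in> G"
proof (induction r)
  case 0 then show ?case by (simp add: field_graph_0[OF assms(1)])
next
  case (pCons c r)
  then show ?case
    by (simp add: map_poly_pCons field_graph_add field_graph_mult field_graph_base assms)
qed

text \<open>
  A nonzero polynomial of least degree that vanishes at \<open>c\<close> has a nonzero constant term, so the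
  equation can be solved for \<open>1/c\<close>. This makes every subring containing the base field a field.
\<close>
lemma alg_closure_inverse_eq_poly:
  fixes c :: "'a::field alg_closure"
  assumes "c \<noteq> 0"
  obtains r :: "'a poly" where "inverse c = poly (map_poly to_ac r) c"
proof -
  define Q where "Q p \<longleftrightarrow> p \<noteq> 0 \<and> poly (map_poly to_ac p) c = 0" for p :: "'a poly"
  obtain p0 where "Q p0"
    using alg_closure_algebraic[of c] unfolding Q_def by metis
  then obtain p where p: "Q p" and min: "\<And>q. Q q \<Longrightarrow> Polynomial.degree p \<le> Polynomial.degree q"
    using ex_has_least_nat[of Q _ Polynomial.degree] by blast
  obtain a r where par: "p = pCons a r" by (cases p) auto
  have eq: "to_ac a + c * poly (map_poly to_ac r) c = 0"
    using p by (simp add: Q_def par map_poly_pCons)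
  have "a \<noteq> 0"
  proof
    assume "a = 0"
    then have "Q r" using p eq assms by (auto simp: Q_def par)
    from min[OF this] p \<open>a = 0\<close> show False by (auto simp: par Q_def)
  qed
  moreover have "map_poly to_ac (Polynomial.smult (- inverse a) r)
                   = Polynomial.smult (- inverse (to_ac a)) (map_poly to_ac r)"
    by (subst map_poly_smult) simp_all
  ultimately have "inverse c = poly (map_poly to_ac (Polynomial.smult (- inverse a) r)) c"
    using eq assms by (simp add: field_simps add_eq_0_iff)
  then show ?thesis using that by blast
qed

lemma field_graph_inverse:
  assumes G: "field_graph G" and cd: "(c, d) \<in> G" and "c \<noteq> 0"
  shows "(inverse c, inverse d) \<in> G" "d \<noteq> 0"
proof -
  obtain r where r: "inverse c = poly (map_poly to_ac r) c"
    using alg_closure_inverse_eq_poly[OF \<open>c \<noteq> 0\<close>] .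
  define d' where "d' = poly (map_poly to_ac r) d"
  have mem: "(inverse c, d') \<in> G"
    using field_graph_poly[OF G cd, of r] by (simp add: r d'_def)
  have "(0, d * d' - 1) \<in> G"
    using field_graph_diff[OF G field_graph_mult[OF G cd mem] field_graph_1[OF G]] assms(3) by simp
  then have "d * d' = 1" using field_graph_0D[OF G] by force
  then show "d \<noteq> 0" by auto
  with \<open>d * d' = 1\<close> have "d' = inverse d" by (simp add: field_simps)
  with mem show "(inverse c, inverse d) \<in> G" by simp
qed

lemma poly_pairs_add:
  "field_graph G \<Longrightarrow> (p, q) \<in> poly_pairs G \<Longrightarrow> (p', q') \<in> poly_pairs G \<Longrightarrow> (p + p', q + q') \<in> poly_pairs G"
  and poly_pairs_diff:
  "field_graph G \<Longrightarrow> (p, q) \<in> poly_pairs G \<Longrightarrow> (p', q') \<in> poly_pairs G \<Longrightarrow> (p - p', q - q') \<in> poly_pairs G"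
  and poly_pairs_mult:
  "field_graph G \<Longrightarrow> (p, q) \<in> poly_pairs G \<Longrightarrow> (p', q') \<in> poly_pairs G \<Longrightarrow> (p * p', q * q') \<in> poly_pairs G"
  and poly_pairs_monom:
  "field_graph G \<Longrightarrow> (a, b) \<in> G \<Longrightarrow> (Polynomial.monom a n, Polynomial.monom b n) \<in> poly_pairs G"
  by (auto simp: poly_pairs_def coeff_mult field_graph_0
           intro!: field_graph_sum field_graph_add field_graph_mult field_graph_diff)

lemma minimal_pair_exists:
  fixes a :: "'a::field alg_closure"
  assumes G: "field_graph G"
  obtains m m' where "minimal_pair G a m m'"
proof -
  define Q where "Q z \<longleftrightarrow> z \<in> poly_pairs G \<and> fst z \<noteq> 0 \<and> poly (fst z) a = 0" for z
  obtain p :: "'a poly" where "p \<noteq> 0" "poly (map_poly to_ac p) a = 0"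
    using alg_closure_algebraic .
  then have "Q (map_poly to_ac p, map_poly to_ac p)"
    by (simp add: Q_def poly_pairs_def coeff_map_poly field_graph_base[OF G] map_poly_eq_0_iff)
  then obtain z where "Q z" "\<And>w. Q w \<Longrightarrow> Polynomial.degree (fst z) \<le> Polynomial.degree (fst w)"
    using ex_has_least_nat[of Q _ "\<lambda>z. Polynomial.degree (fst z)"] by blast
  then have "minimal_pair G a (fst z) (snd z)"
    by (force simp: minimal_pair_def Q_def)
  then show ?thesis by (rule that)
qed

lemma minimal_pair_degree_pos:
  assumes G: "field_graph G" and m: "minimal_pair G a m m'"
  shows "0 < Polynomial.degree m" "0 < Polynomial.degree m'"
proof -
  have 1: "(m, m') \<in> poly_pairs G" "m \<noteq> 0" "poly m a = 0"
    using m by (simp_all add: minimal_pair_def)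
  show 2: "0 < Polynomial.degree m"
    using 1(2,3) by (metis gr0I degree_eq_zeroE poly_pCons poly_0 add_cancel_left_right mult_zero_right pCons_0_0)
  have "poly.coeff m' (Polynomial.degree m) \<noteq> 0"
    using field_graph_inverse(2)[OF G, of "Polynomial.lead_coeff m"] 1 by (auto simp: poly_pairs_def)
  then show "0 < Polynomial.degree m'" using 2 le_degree by fastforce
qed

text \<open>
  Simple extensions: \<open>a\<close> may be sent to any root \<open>b\<close> of the image of its minimal polynomial. The
  new graph is the set of all values \<open>(p(a), q(b))\<close>; it is well defined because \<open>p(a) = 0\<close> forces
  \<open>q(b) = 0\<close>, which follows by dividing \<open>p\<close> by the minimal polynomial.
\<close>
lemma field_graph_extend:
  assumes G: "field_graph G"
    and min_pair: "minimal_pair G a m m'" and root: "poly m' b = 0"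
  obtains G' where "field_graph G'" "G \<subseteq> G'" "(a, b) \<in> G'"
proof -
  have m: "(m, m') \<in> poly_pairs G" "m \<noteq> 0" "poly m a = 0" "poly m' b = 0"
    and minimal: "\<And>p q. (p, q) \<in> poly_pairs G \<Longrightarrow> p \<noteq> 0 \<Longrightarrow> poly p a = 0 \<Longrightarrow>
                    Polynomial.degree m \<le> Polynomial.degree p"
    using min_pair root by (auto simp: minimal_pair_def)
  have deg_m: "0 < Polynomial.degree m"
    using minimal_pair_degree_pos[OF G min_pair] by simp
  have key: "poly q b = 0" if "(p, q) \<in> poly_pairs G" "poly p a = 0" for p q
    using that
  proof (induction "Polynomial.degree p" arbitrary: p q rule: less_induct)
    case less
    show ?case
    proof (cases "p = 0")
      case True
      then have "q = 0"
        using less.prems(1) by (intro poly_eqI) (auto simp: poly_pairs_def intro: field_graph_0D[OF G])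
      then show ?thesis by simp
    next
      case False
      let ?d = "Polynomial.degree p" and ?e = "Polynomial.degree m"
      have le: "?e \<le> ?d" using minimal[OF less.prems(1) False less.prems(2)] .
      define c where "c = Polynomial.lead_coeff p * inverse (Polynomial.lead_coeff m)"
      define c' where "c' = poly.coeff q ?d * inverse (poly.coeff m' ?e)"
      have "(c, c') \<in> G"
        using less.prems(1) m(1,2) unfolding c_def c'_def poly_pairs_def
        by (auto intro!: field_graph_mult[OF G] field_graph_inverse[OF G])
      \<comment> \<open>One step of the division of $p$ by $m$, carried out simultaneously on both components.\<close>
      define p1 where "p1 = p - Polynomial.monom c (?d - ?e) * m"
      define q1 where "q1 = q - Polynomial.monom c' (?d - ?e) * m'"
      have pq: "(p1, q1) \<in> poly_pairs G"
        unfolding p1_def q1_def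
        by (intro poly_pairs_diff poly_pairs_mult poly_pairs_monom G less.prems m \<open>(c, c') \<in> G\<close>)
      have "Polynomial.degree p1 \<le> ?d"
        unfolding p1_def
        by (rule degree_diff_le[OF order.refl])
           (rule order.trans[OF degree_mult_le], use degree_monom_le[of c "?d - ?e"] le in linarith)
      moreover have "poly.coeff p1 ?d = 0"
        using le m(2) by (simp add: p1_def c_def coeff_monom_mult)
      ultimately have "Polynomial.degree p1 < ?d"
        using deg_m le
        by (metis eq_zero_or_degree_less order.strict_trans2 degree_0)
      moreover have "poly p1 a = 0" by (simp add: p1_def less.prems m)
      ultimately have "poly q1 b = 0" using less.hyps pq by blast
      then show ?thesis by (simp add: q1_def m)
    qed
  qed
  define G' where "G' = {(poly p a, poly q b) | p q. (p, q) \<in> poly_pairs G}"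
  have G'I: "(poly p a, poly q b) \<in> G'" if "(p, q) \<in> poly_pairs G" for p q
    using that by (auto simp: G'_def)
  have sub: "G \<subseteq> G'"
  proof
    fix z assume "z \<in> G"
    then show "z \<in> G'"
      using G'I[OF poly_pairs_monom[OF G, of "fst z" "snd z" 0]] by (simp add: poly_monom)
  qed
  have "field_graph G'"
    unfolding field_graph_def
  proof (intro conjI allI impI)
    show "(to_ac q, to_ac q) \<in> G'" for q using sub field_graph_base[OF G] by auto
  next
    fix x y z w assume "(x, y) \<in> G'" "(z, w) \<in> G'"
    then obtain p q r s where pq: "(p, q) \<in> poly_pairs G" "(r, s) \<in> poly_pairs G"
      and "x = poly p a" "y = poly q b" "z = poly r a" "w = poly s b"
      by (auto simp: G'_def)
    then show "(x + z, y + w) \<in> G'" "(x * z, y * w) \<in> G'"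
      using G'I[OF poly_pairs_add[OF G pq]] G'I[OF poly_pairs_mult[OF G pq]] by simp_all
  next
    fix y assume "(0, y) \<in> G'"
    then show "y = 0" using key by (auto simp: G'_def)
  qed
  moreover have "(a, b) \<in> G'"
    using G'I[OF poly_pairs_monom[OF G field_graph_1[OF G], of 1]] by (simp add: poly_monom)
  ultimately show ?thesis using that sub by blast
qed

text \<open>
  A maximal graph is defined everywhere by the extension step. The resulting endomorphism is onto
  because it permutes the finitely many roots of every rational polynomial.
\<close>
lemma field_graph_extends_to_automorphism:
  assumes G0: "field_graph G0"
  obtains \<sigma> where "\<sigma> \<in> galois_group" "\<forall>(a, b) \<in> G0. \<sigma> a = b"
proof -
  define A where "A = {G. field_graph G \<and> G0 \<subseteq> G}"
  have "\<exists>N\<in>A. \<forall>H\<in>A. N \<subseteq> H \<longrightarrow> H = N"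
  proof (rule subset_Zorn_nonempty)
    show "A \<noteq> {}" using G0 by (auto simp: A_def)
  next
    fix C assume ne: "C \<noteq> {}" and C: "subset.chain A C"
    then have mem: "\<And>G. G \<in> C \<Longrightarrow> field_graph G \<and> G0 \<subseteq> G"
      and chain: "\<And>H N. H \<in> C \<Longrightarrow> N \<in> C \<Longrightarrow> H \<subseteq> N \<or> N \<subseteq> H"
      by (auto simp: subset_chain_def A_def)
    have "field_graph (\<Union>C)"
      unfolding field_graph_def
    proof (intro conjI allI impI)
      show "(to_ac q, to_ac q) \<in> \<Union>C" for q using ne mem field_graph_base by blast
    next
      fix a b c d assume "(a, b) \<in> \<Union>C" "(c, d) \<in> \<Union>C"
      then obtain H where "H \<in> C" "(a, b) \<in> H" "(c, d) \<in> H" using chain by blast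
      then show "(a + c, b + d) \<in> \<Union>C" "(a * c, b * d) \<in> \<Union>C"
        using mem field_graph_add field_graph_mult by blast+
    next
      fix b assume "(0, b) \<in> \<Union>C" then show "b = 0" using mem field_graph_0D by blast
    qed
    then show "\<Union>C \<in> A" using ne mem by (auto simp: A_def)
  qed
  then obtain M where "M \<in> A" and maxA: "\<forall>H\<in>A. M \<subseteq> H \<longrightarrow> H = M" by blast
  then have M: "field_graph M" "G0 \<subseteq> M" by (simp_all add: A_def)
  have max: "H = M" if "field_graph H" "M \<subseteq> H" for H
  proof -
    have "H \<in> A" using that M(2) by (simp add: A_def)
    with maxA \<open>M \<subseteq> H\<close> show ?thesis by simp
  qed
  have "\<exists>b. (a, b) \<in> M" for a
  proof -
    obtain m m' where m: "minimal_pair M a m m'"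
      using minimal_pair_exists[OF M(1)] .
    obtain b where "poly m' b = 0"
      using alg_closed_imp_poly_has_root[OF minimal_pair_degree_pos(2)[OF M(1) m]] by blast
    from field_graph_extend[OF M(1) m this] obtain G'
      where "field_graph G'" "M \<subseteq> G'" "(a, b) \<in> G'" .
    with max show ?thesis by blast
  qed
  moreover have uniq: "b = c" if "(a, b) \<in> M" "(a, c) \<in> M" for a b c
    using field_graph_0D[OF M(1), of "b - c"] field_graph_diff[OF M(1) that] by simp
  ultimately have "\<exists>!b. (a, b) \<in> M" for a by blast
  then obtain \<sigma> where \<sigma>: "\<And>a b. (a, b) \<in> M \<longleftrightarrow> \<sigma> a = b" by metis
  have add: "\<sigma> (x + y) = \<sigma> x + \<sigma> y" for x y using field_graph_add[OF M(1)] by (simp add: \<sigma>)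
  have mult: "\<sigma> (x * y) = \<sigma> x * \<sigma> y" for x y using field_graph_mult[OF M(1)] by (simp add: \<sigma>)
  have base: "\<sigma> (to_ac q) = to_ac q" for q using field_graph_base[OF M(1)] by (simp add: \<sigma>)
  have inj: "inj \<sigma>"
  proof (rule injI)
    fix x y assume "\<sigma> x = \<sigma> y"
    then have "(x - y, 0) \<in> M" using field_graph_diff[OF M(1), of x "\<sigma> x" y "\<sigma> y"] by (simp add: \<sigma>)
    then show "x = y" using field_graph_inverse(2)[OF M(1), of "x - y" 0] by auto
  qed
  have "surj \<sigma>"
    unfolding surj_def
  proof
    fix y
    obtain p :: "rat poly" where p: "p \<noteq> 0" "poly (map_poly to_ac p) y = 0"
      using alg_closure_algebraic .
    define Z where "Z = {z. poly (map_poly to_ac p) z = 0}"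
    have "\<sigma> (poly (map_poly to_ac r) z) = poly (map_poly to_ac r) (\<sigma> z)" for r z
      using field_graph_poly[OF M(1), of z "\<sigma> z" r] by (simp add: \<sigma>)
    moreover have "\<sigma> 0 = 0" using field_graph_0[OF M(1)] by (simp add: \<sigma>)
    ultimately have "\<sigma> ` Z \<subseteq> Z" by (auto simp: Z_def) metis
    moreover have "finite Z"
      unfolding Z_def by (rule poly_roots_finite) (simp add: p map_poly_eq_0_iff)
    ultimately have "\<sigma> ` Z = Z" using inj by (meson endo_inj_surj inj_on_subset subset_UNIV)
    moreover have "y \<in> Z" using p by (simp add: Z_def)
    ultimately show "\<exists>x. y = \<sigma> x" by blast
  qed
  with inj add mult base have "\<sigma> \<in> galois_group" by (simp add: galois_group_def bij_def)
  moreover have "\<forall>(a, b) \<in> G0. \<sigma> a = b" using M(2) \<sigma> by blast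
  ultimately show ?thesis by (rule that)
qed

text \<open>
  In characteristic 0 the minimal polynomial of \<open>a\<close> has \<open>a\<close> as a simple root, as its derivative
  has smaller degree. If \<open>a\<close> is not rational, the cofactor of \<open>X - a\<close> is not constant and has a
  root \<open>b\<close> different from \<open>a\<close>; the embedding that sends \<open>a\<close> to \<open>b\<close> extends to an
  automorphism.
\<close>
lemma alg_closure_moved_by_automorphism:
  assumes "a \<notin> range to_ac"
  obtains \<sigma> where "\<sigma> \<in> galois_group" "\<sigma> a \<noteq> a"
proof -
  define G where "G = range (\<lambda>q :: rat. (to_ac q, to_ac q))"
  have G: "field_graph G"
    unfolding field_graph_def G_def
    by (auto simp: image_iff simp flip: to_ac_add to_ac_mult)
  obtain m m' where min_pair: "minimal_pair G a m m'"
    using minimal_pair_exists[OF G] .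
  then have m: "(m, m') \<in> poly_pairs G" "m \<noteq> 0" "poly m a = 0" "0 < Polynomial.degree m"
    and min: "\<And>p q. (p, q) \<in> poly_pairs G \<Longrightarrow> p \<noteq> 0 \<Longrightarrow> poly p a = 0 \<Longrightarrow>
         Polynomial.degree m \<le> Polynomial.degree p"
    using minimal_pair_degree_pos[OF G min_pair] by (auto simp: minimal_pair_def)
  have coeffs: "poly.coeff m i \<in> range to_ac" "poly.coeff m' i = poly.coeff m i" for i
  proof -
    have "(poly.coeff m i, poly.coeff m' i) \<in> G" using m(1) by (simp add: poly_pairs_def)
    then show "poly.coeff m i \<in> range to_ac" "poly.coeff m' i = poly.coeff m i" by (auto simp: G_def)
  qed
  then have "m' = m" by (simp add: poly_eq_iff)
  have "(pderiv m, pderiv m) \<in> poly_pairs G"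
  proof -
    have "(poly.coeff (pderiv m) i, poly.coeff (pderiv m) i) \<in> G" for i
    proof -
      obtain q where "poly.coeff m (Suc i) = to_ac q" using coeffs(1)[of "Suc i"] by (rule rangeE)
      then have "poly.coeff (pderiv m) i = to_ac (of_nat (Suc i) * q)"
        by (simp add: coeff_pderiv del: of_nat_Suc)
      then show ?thesis unfolding G_def by (intro range_eqI[of _ _ "of_nat (Suc i) * q"]) simp
    qed
    then show ?thesis by (simp add: poly_pairs_def)
  qed
  moreover have "pderiv m \<noteq> 0" using m(4) by (simp add: pderiv_eq_0_iff)
  ultimately have simple: "poly (pderiv m) a \<noteq> 0"
    using min[of "pderiv m" "pderiv m"] m(4) by (auto simp: degree_pderiv)
  have "[:- a, 1:] dvd m" using m(3) by (simp add: poly_eq_0_iff_dvd)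
  then obtain h where h: "m = [:- a, 1:] * h" by (rule dvdE)
  have "poly h a \<noteq> 0"
    using simple by (simp add: h pderiv_mult pderiv_pCons del: mult_pCons_left)
  have "0 < Polynomial.degree h"
  proof (rule ccontr)
    assume "\<not> 0 < Polynomial.degree h"
    then obtain c where c: "h = [:c:]" by (metis degree_eq_zeroE gr0I)
    with m(2) h have "c \<noteq> 0" by auto
    obtain u where u: "- a * c = to_ac u" using coeffs(1)[of 0] by (auto simp: h c mult.commute)
    obtain v where v: "c = to_ac v" using coeffs(1)[of 1] by (auto simp: h c)
    have "a = - to_ac u / c" using \<open>c \<noteq> 0\<close> by (simp flip: u)
    then have "a = to_ac (- u / v)" by (simp add: v)
    with assms show False by blast
  qed
  then obtain b where b: "poly h b = 0" using alg_closed_imp_poly_has_root by blast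
  then have "poly m' b = 0" by (simp add: \<open>m' = m\<close> h)
  from field_graph_extend[OF G min_pair this] obtain G'
    where "field_graph G'" "G \<subseteq> G'" "(a, b) \<in> G'" .
  from field_graph_extends_to_automorphism[OF \<open>field_graph G'\<close>] obtain \<sigma> where
    \<sigma>: "\<sigma> \<in> galois_group" "\<forall>(x, y) \<in> G'. \<sigma> x = y" .
  have "\<sigma> a \<noteq> a" using \<sigma>(2) \<open>(a, b) \<in> G'\<close> b \<open>poly h a \<noteq> 0\<close> by auto
  with \<sigma>(1) show ?thesis by (rule that)
qed

lemma fixed_by_galois_group_iff: "(\<forall>\<sigma>\<in>galois_group. \<sigma> x = x) \<longleftrightarrow> x \<in> range to_ac"
proof
  assume fixed: "\<forall>\<sigma>\<in>galois_group. \<sigma> x = x"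
  show "x \<in> range to_ac"
  proof (rule ccontr)
    assume "x \<notin> range to_ac"
    then obtain \<sigma> where "\<sigma> \<in> galois_group" "\<sigma> x \<noteq> x"
      by (rule alg_closure_moved_by_automorphism)
    with fixed show False by simp
  qed
qed (auto simp: galois_group_def)

section \<open>Halving a 2-torsion point\<close>

text \<open>
  The difference of the $y$-coordinates of a point and its negative: the coordinate $\eta$ that
  completes the square, which vanishes exactly at the points of order 2.
\<close>
fun vertical_gap :: "'a::field weierstrass \<Rightarrow> 'a \<Rightarrow> 'a \<Rightarrow> 'a" where
  "vertical_gap (Weierstrass a1 a2 a3 a4 a6) x y = 2 * y + a1 * x + a3"

text \<open>
  The polynomial $g(x) = 4x^3 + b_2 x^2 + 2 b_4 x + b_6$, whose roots are the $x$-coordinates of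
  the points of order 2.
\<close>
fun two_division :: "'a::field weierstrass \<Rightarrow> 'a \<Rightarrow> 'a" where
  "two_division (Weierstrass a1 a2 a3 a4 a6) x =
     4 * x^3 + (a1^2 + 4 * a2) * x^2 + 2 * (2 * a4 + a1 * a3) * x + (a3^2 + 4 * a6)"

text \<open>
  A quarter of the derivative $g'(e)$. At a root $e$ of $g$ this is the square of
  $x(P) - e$ for the points $P$ whose double is the point of order 2 above $e$.
\<close>
fun halving_square :: "'a::field weierstrass \<Rightarrow> 'a \<Rightarrow> 'a" where
  "halving_square (Weierstrass a1 a2 a3 a4 a6) e =
     3 * e^2 + (a1^2 + 4 * a2) / 2 * e + (2 * a4 + a1 * a3) / 2"

fun neg_point :: "'a::field weierstrass \<Rightarrow> 'a point \<Rightarrow> 'a point" where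
  "neg_point W Infinity = Infinity"
| "neg_point (Weierstrass a1 a2 a3 a4 a6) (Affine x y) = Affine x (- y - a1 * x - a3)"

lemma vertical_gap_square:
  "(vertical_gap W x y)^2 = two_division W x + 4 * weierstrass_eval W x y"
  by (cases W) (simp add: algebra_simps power2_eq_square power3_eq_cube)

lemma on_curve_iff:
  fixes x y :: "'a::field_char_0"
  shows "on_curve W (Affine x y) \<longleftrightarrow> (vertical_gap W x y)^2 = two_division W x"
  by (simp add: vertical_gap_square)

text \<open>
  A common root of $g$ and $g'$ expresses $b_4$ and $b_6$ through $e$ and $b_2$, and with these
  values the discriminant vanishes.
\<close>
lemma elliptic_curve_no_double_root:
  fixes e :: "'a::field_char_0"
  assumes "elliptic_curve W" "two_division W e = 0"
  shows "halving_square W e \<noteq> 0"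
proof
  assume B: "halving_square W e = 0"
  obtain a1 a2 a3 a4 a6 where W: "W = Weierstrass a1 a2 a3 a4 a6" by (cases W)
  define b2 b4 b6 where "b2 = a1^2 + 4 * a2" and "b4 = 2 * a4 + a1 * a3" and "b6 = a3^2 + 4 * a6"
  have "3 * e^2 + b2 / 2 * e + b4 / 2 = 0" using B by (simp add: W b2_def b4_def)
  then have "6 * e^2 + b2 * e + b4 = 0" by (simp add: field_simps)
  then have b4: "b4 = - 6 * e^2 - b2 * e" by Groebner_Basis.algebra
  have "4 * e^3 + b2 * e^2 + 2 * b4 * e + b6 = 0"
    using assms(2) by (simp add: W b2_def b4_def b6_def)
  then have b6: "b6 = 8 * e^3 + b2 * e^2" unfolding b4 by Groebner_Basis.algebra
  have "4 * discriminant W = - (b2^2 * (b2 * b6 - b4^2)) - 32 * b4^3 - 108 * b6^2 + 36 * b2 * b4 * b6"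
    unfolding W discriminant.simps Let_def b2_def b4_def b6_def by Groebner_Basis.algebra
  also have "\<dots> = 0" unfolding b4 b6 by Groebner_Basis.algebra
  finally show False using assms(1) by (simp add: elliptic_curve_def)
qed

text \<open>
  Halving a point of order 2 does not give a point of order 2. If $x$ were a second root of
  $g$, then $(x - e)^2 = g'(e)/4$ would make it a double root.
\<close>
lemma two_division_at_half_nonzero:
  fixes e x :: "'a::field_char_0"
  assumes ell: "elliptic_curve W" and e: "two_division W e = 0" and x: "(x - e)^2 = halving_square W e"
  shows "two_division W x \<noteq> 0" "x \<noteq> e"
proof -
  show ne: "x \<noteq> e" using elliptic_curve_no_double_root[OF ell e] x by (metis power_zero_numeral right_minus_eq)
  show "two_division W x \<noteq> 0"
  proof
    assume gx: "two_division W x = 0"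
    obtain a1 a2 a3 a4 a6 where W: "W = Weierstrass a1 a2 a3 a4 a6" by (cases W)
    define b2 b4 b6 where "b2 = a1^2 + 4 * a2" and "b4 = 2 * a4 + a1 * a3" and "b6 = a3^2 + 4 * a6"
    have "(x - e)^2 = 3 * e^2 + b2 / 2 * e + b4 / 2" using x by (simp add: W b2_def b4_def)
    then have b4: "b4 = 2 * (x - e)^2 - 6 * e^2 - b2 * e" by (simp add: field_simps)
    have "4 * e^3 + b2 * e^2 + 2 * b4 * e + b6 = 0" "4 * x^3 + b2 * x^2 + 2 * b4 * x + b6 = 0"
      using e gx by (simp_all add: W b2_def b4_def b6_def)
    moreover have "(x - e)^2 * (8 * x + 4 * e + b2)
      = (4 * x^3 + b2 * x^2 + 2 * b4 * x + b6) - (4 * e^3 + b2 * e^2 + 2 * b4 * e + b6)"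
      unfolding b4 by Groebner_Basis.algebra
    ultimately have "(x - e)^2 * (8 * x + 4 * e + b2) = 0" by simp
    then have "8 * x + 4 * e + b2 = 0" using ne by simp
    then have b2: "b2 = - 8 * x - 4 * e" by Groebner_Basis.algebra
    have "6 * x^2 + b2 * x + b4 = 0" unfolding b4 b2 by Groebner_Basis.algebra
    moreover have "halving_square W x = (6 * x^2 + b2 * x + b4) / 2"
      by (simp add: W b2_def b4_def field_simps)
    ultimately have "halving_square W x = 0" by simp
    with elliptic_curve_no_double_root[OF ell gx] show False by simp
  qed
qed

lemma point_double:
  assumes "vertical_gap (Weierstrass a1 a2 a3 a4 a6) x y \<noteq> 0"
  obtains l where "l * (2 * y + a1 * x + a3) = 3 * x^2 + 2 * a2 * x + a4 - a1 * y"
    "point_add (Weierstrass a1 a2 a3 a4 a6) (Affine x y) (Affine x y) =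
       Affine (l^2 + a1 * l - a2 - 2 * x)
         (- ((l + a1) * (l^2 + a1 * l - a2 - 2 * x)) - (y - l * x) - a3)"
proof -
  define l where "l = (3 * x^2 + 2 * a2 * x + a4 - a1 * y) / (2 * y + a1 * x + a3)"
  have gap: "2 * y + a1 * x + a3 \<noteq> 0" using assms by simp
  moreover have "y + y + a1 * x + a3 = 2 * y + a1 * x + a3" by simp
  ultimately have "point_add (Weierstrass a1 a2 a3 a4 a6) (Affine x y) (Affine x y) =
      Affine (l^2 + a1 * l - a2 - x - x) (- ((l + a1) * (l^2 + a1 * l - a2 - x - x)) - (y - l * x) - a3)"
    by (simp only: point_add.simps Let_def l_def simp_thms if_True if_False)
  moreover have "l^2 + a1 * l - a2 - x - x = l^2 + a1 * l - a2 - 2 * x" by simp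
  moreover have "l * (2 * y + a1 * x + a3) = 3 * x^2 + 2 * a2 * x + a4 - a1 * y"
    using gap by (simp only: l_def nonzero_eq_divide_eq[symmetric] simp_thms)
  ultimately show ?thesis using that by metis
qed

text \<open>
  Along the tangent at $P$ the equation of the curve has a double zero at $x(P)$; the abscissa
  \<open>x + d\<close> is chosen as its third zero.
\<close>
lemma on_curve_double:
  assumes "on_curve W (Affine x y)" "vertical_gap W x y \<noteq> 0"
  shows "on_curve W (point_add W (Affine x y) (Affine x y))"
proof -
  obtain a1 a2 a3 a4 a6 where W: "W = Weierstrass a1 a2 a3 a4 a6" by (cases W)
  obtain l where l: "l * (2 * y + a1 * x + a3) = 3 * x^2 + 2 * a2 * x + a4 - a1 * y"
    and P: "point_add W (Affine x y) (Affine x y) =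
       Affine (l^2 + a1 * l - a2 - 2 * x)
         (- ((l + a1) * (l^2 + a1 * l - a2 - 2 * x)) - (y - l * x) - a3)"
    using point_double[of a1 a2 a3 a4 a6 x y] assms(2) unfolding W by blast
  define d where "d = l^2 + a1 * l - a2 - 3 * x"
  have "weierstrass_eval W (x + d) (- (y + l * d) - a1 * (x + d) - a3)
      = weierstrass_eval W x y
        + d * (l * (2 * y + a1 * x + a3) - (3 * x^2 + 2 * a2 * x + a4 - a1 * y))
        + d^2 * (l^2 + a1 * l - a2 - 3 * x - d)"
    unfolding W weierstrass_eval.simps by Groebner_Basis.algebra
  also have "\<dots> = 0" using assms(1) by (simp add: l d_def)
  finally have "on_curve W (Affine (x + d) (- (y + l * d) - a1 * (x + d) - a3))" by simp
  moreover have "x + d = l^2 + a1 * l - a2 - 2 * x"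
    "- (y + l * d) - a1 * (x + d) - a3
       = - ((l + a1) * (l^2 + a1 * l - a2 - 2 * x)) - (y - l * x) - a3"
    unfolding d_def by (Groebner_Basis.algebra+)
  ultimately show ?thesis by (simp only: P)
qed

text \<open>
  Negation carries the tangent at $P$, of slope $l$, to the tangent at $-P$, of slope $-l - a_1$.
\<close>
lemma neg_point_double:
  assumes "vertical_gap W x y \<noteq> 0"
  shows "point_add W (neg_point W (Affine x y)) (neg_point W (Affine x y))
           = neg_point W (point_add W (Affine x y) (Affine x y))"
proof -
  obtain a1 a2 a3 a4 a6 where W: "W = Weierstrass a1 a2 a3 a4 a6" by (cases W)
  define y' where "y' = - y - a1 * x - a3"
  have "2 * y' + a1 * x + a3 = - (2 * y + a1 * x + a3)" unfolding y'_def by Groebner_Basis.algebra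
  then have gap: "2 * y + a1 * x + a3 \<noteq> 0" "2 * y' + a1 * x + a3 \<noteq> 0"
    using assms by (simp_all only: W vertical_gap.simps neg_equal_0_iff_equal not_False_eq_True)
  obtain l where l: "l * (2 * y + a1 * x + a3) = 3 * x^2 + 2 * a2 * x + a4 - a1 * y"
    and P: "point_add W (Affine x y) (Affine x y) =
       Affine (l^2 + a1 * l - a2 - 2 * x)
         (- ((l + a1) * (l^2 + a1 * l - a2 - 2 * x)) - (y - l * x) - a3)"
    using point_double[of a1 a2 a3 a4 a6 x y] assms unfolding W by blast
  obtain k where k: "k * (2 * y' + a1 * x + a3) = 3 * x^2 + 2 * a2 * x + a4 - a1 * y'"
    and Q: "point_add W (Affine x y') (Affine x y') =
       Affine (k^2 + a1 * k - a2 - 2 * x)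
         (- ((k + a1) * (k^2 + a1 * k - a2 - 2 * x)) - (y' - k * x) - a3)"
    using point_double[of a1 a2 a3 a4 a6 x y'] gap unfolding W by auto
  have "(k + l + a1) * (2 * y + a1 * x + a3) = 0"
    using l k unfolding y'_def by Groebner_Basis.algebra
  then have "k + l + a1 = 0" using gap by simp
  then have "k = - l - a1" by Groebner_Basis.algebra
  have "k^2 + a1 * k - a2 - 2 * x = l^2 + a1 * l - a2 - 2 * x"
    unfolding \<open>k = - l - a1\<close> by Groebner_Basis.algebra
  moreover have "- ((k + a1) * t) - (y' - k * x) - a3
      = - (- ((l + a1) * t) - (y - l * x) - a3) - a1 * t - a3" for t
    unfolding \<open>k = - l - a1\<close> y'_def by Groebner_Basis.algebra
  moreover have "neg_point W (Affine x y) = Affine x y'" by (simp add: W y'_def)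
  moreover have "neg_point W (Affine u v) = Affine u (- v - a1 * u - a3)" for u v by (simp add: W)
  ultimately show ?thesis by (simp only: P Q)
qed

text \<open>
  In the coordinate $\eta$ the tangent at $P$ has slope $m = g'(x)/(2\eta)$ and the double has
  abscissa $(m^2 - b_2)/4 - 2x$. Equating this with a root $e$ of $g$ and clearing $\eta^2 = g(x)$
  yields a perfect square: $((x - e)^2 - g'(e)/4)^2 = 0$.
\<close>
lemma double_eq_two_torsion:
  fixes x y e f :: "'a::field_char_0"
  assumes P: "on_curve W (Affine x y)" "vertical_gap W x y \<noteq> 0"
    and dbl: "point_add W (Affine x y) (Affine x y) = Affine e f" and f: "vertical_gap W e f = 0"
  shows "two_division W e = 0" "(x - e)^2 = halving_square W e"
proof -
  obtain a1 a2 a3 a4 a6 where W: "W = Weierstrass a1 a2 a3 a4 a6" by (cases W)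
  have "on_curve W (Affine e f)" using on_curve_double[OF P] dbl by simp
  then show e: "two_division W e = 0" using f by (metis on_curve_iff power_zero_numeral)
  obtain l where l: "l * (2 * y + a1 * x + a3) = 3 * x^2 + 2 * a2 * x + a4 - a1 * y"
    and D: "point_add W (Affine x y) (Affine x y) =
       Affine (l^2 + a1 * l - a2 - 2 * x)
         (- ((l + a1) * (l^2 + a1 * l - a2 - 2 * x)) - (y - l * x) - a3)"
    using point_double[of a1 a2 a3 a4 a6 x y] P unfolding W by blast
  define b2 b4 b6 where "b2 = a1^2 + 4 * a2" and "b4 = 2 * a4 + a1 * a3" and "b6 = a3^2 + 4 * a6"
  define h where "h = 2 * y + a1 * x + a3"
  define m where "m = 2 * l + a1"
  have mh: "m * h = 6 * x^2 + b2 * x + b4" using l unfolding m_def h_def b2_def b4_def by Groebner_Basis.algebra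
  have hh: "h^2 = 4 * x^3 + b2 * x^2 + 2 * b4 * x + b6"
    using P(1)[unfolded on_curve_iff] by (simp add: W h_def b2_def b4_def b6_def)
  have ge: "4 * e^3 + b2 * e^2 + 2 * b4 * e + b6 = 0" using e by (simp add: W b2_def b4_def b6_def)
  have "e = l^2 + a1 * l - a2 - 2 * x" using dbl D by simp
  then have mm: "m^2 = 4 * e + 8 * x + b2" unfolding m_def b2_def by Groebner_Basis.algebra
  \<comment> \<open>Eliminate $m$ and $h$: the left side is $(mh)^2$, the right side $m^2 h^2$.\<close>
  have "(6 * x^2 + b2 * x + b4)^2 = (4 * e + 8 * x + b2) * (4 * x^3 + b2 * x^2 + 2 * b4 * x + b6)"
    unfolding mh[symmetric] mm[symmetric] hh[symmetric] by Groebner_Basis.algebra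
  moreover have b6: "b6 = - (4 * e^3 + b2 * e^2 + 2 * b4 * e)" using ge by Groebner_Basis.algebra
  have "(2 * (x - e)^2 - (6 * e^2 + b2 * e + b4))^2
      = (6 * x^2 + b2 * x + b4)^2 - (4 * e + 8 * x + b2) * (4 * x^3 + b2 * x^2 + 2 * b4 * x + b6)"
    unfolding b6 by Groebner_Basis.algebra
  ultimately have "(2 * (x - e)^2 - (6 * e^2 + b2 * e + b4))^2 = 0" by simp
  then have "2 * (x - e)^2 = 6 * e^2 + b2 * e + b4" by simp
  also have "\<dots> = 2 * halving_square W e"
    by (simp add: W b2_def b4_def field_simps)
  finally show "(x - e)^2 = halving_square W e" by simp
qed

text \<open>
  The tangent at $P$ passes through $T = (e, f)$, and it touches the curve at $P$. So the line is
  at the same time the tangent used for $2P$ and the chord through $P$ and $T$: its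
  intersection points $P, P, T$ give $2P = -T = T$ and $P + T = -P$.
\<close>
lemma double_at_half:
  fixes x y e f :: "'a::field_char_0"
  assumes P: "on_curve W (Affine x y)" "vertical_gap W x y \<noteq> 0" and "x \<noteq> e"
    and e: "two_division W e = 0" "(x - e)^2 = halving_square W e" and f: "vertical_gap W e f = 0"
  shows "point_add W (Affine x y) (Affine x y) = Affine e f"
    "point_add W (Affine x y) (Affine e f) = neg_point W (Affine x y)"
    "point_add W (Affine e f) (Affine x y) = neg_point W (Affine x y)"
proof -
  obtain a1 a2 a3 a4 a6 where W: "W = Weierstrass a1 a2 a3 a4 a6" by (cases W)
  obtain l where l: "l * (2 * y + a1 * x + a3) = 3 * x^2 + 2 * a2 * x + a4 - a1 * y"
    and D: "point_add W (Affine x y) (Affine x y) =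
       Affine (l^2 + a1 * l - a2 - 2 * x)
         (- ((l + a1) * (l^2 + a1 * l - a2 - 2 * x)) - (y - l * x) - a3)"
    using point_double[of a1 a2 a3 a4 a6 x y] P unfolding W by blast
  define b2 b4 b6 where "b2 = a1^2 + 4 * a2" and "b4 = 2 * a4 + a1 * a3" and "b6 = a3^2 + 4 * a6"
  define h where "h = 2 * y + a1 * x + a3"
  define m where "m = 2 * l + a1"
  have "h \<noteq> 0" using P by (simp add: W h_def)
  have mh: "m * h = 6 * x^2 + b2 * x + b4" using l unfolding m_def h_def b2_def b4_def by Groebner_Basis.algebra
  have hh: "h^2 = 4 * x^3 + b2 * x^2 + 2 * b4 * x + b6"
    using P(1)[unfolded on_curve_iff] by (simp add: W h_def b2_def b4_def b6_def)
  have ge: "4 * e^3 + b2 * e^2 + 2 * b4 * e + b6 = 0" using e by (simp add: W b2_def b4_def b6_def)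
  then have b6: "b6 = - (4 * e^3 + b2 * e^2 + 2 * b4 * e)" by Groebner_Basis.algebra
  have "2 * (x - e)^2 = 2 * halving_square W e" by (simp add: e)
  also have "\<dots> = 6 * e^2 + b2 * e + b4" by (simp add: W b2_def b4_def field_simps)
  finally have b4: "b4 = 2 * (x - e)^2 - 6 * e^2 - b2 * e" by Groebner_Basis.algebra
  have f: "2 * f + a1 * e + a3 = 0" using f by (simp add: W)
  have "h * (m * (x - e) - h) = (x - e) * (m * h) - h^2" by Groebner_Basis.algebra
  also have "\<dots> = 0" unfolding mh hh b6 b4 by Groebner_Basis.algebra
  finally have "h * (m * (x - e) - h) = 0" .
  then have tangent: "m * (x - e) = h" using \<open>h \<noteq> 0\<close> by simp
  have "2 * (l * (x - e) - (y - f)) = 0"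
    using tangent f unfolding m_def h_def by Groebner_Basis.algebra
  then have chord: "l * (x - e) = y - f"
    by (simp only: mult_eq_0_iff zero_neq_numeral[symmetric] simp_thms right_minus_eq)
  have "(x - e)^2 * (m^2 - (8 * x + 4 * e + b2))
          = (m * (x - e))^2 - (x - e)^2 * (8 * x + 4 * e + b2)" by Groebner_Basis.algebra
  also have "\<dots> = 0" unfolding tangent hh b6 b4 by Groebner_Basis.algebra
  finally have "(x - e)^2 * (m^2 - (8 * x + 4 * e + b2)) = 0" .
  then have mm: "m^2 = 8 * x + 4 * e + b2" using \<open>x \<noteq> e\<close> by simp
  have "4 * (l^2 + a1 * l - a2 - 2 * x - e) = 0"
    using mm unfolding m_def b2_def by Groebner_Basis.algebra
  then have xe: "l^2 + a1 * l - a2 - 2 * x = e"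
    by (simp only: mult_eq_0_iff zero_neq_numeral[symmetric] simp_thms right_minus_eq)
  have "- ((l + a1) * e) - (y - l * x) - a3 = f"
    using chord f by Groebner_Basis.algebra
  then show "point_add W (Affine x y) (Affine x y) = Affine e f"
    unfolding D xe by simp
  have xx: "l^2 + a1 * l - a2 - x - e = x" "l^2 + a1 * l - a2 - e - x = x"
    unfolding xe[symmetric] by simp_all
  have slope: "(f - y) / (e - x) = l" "(y - f) / (x - e) = l"
    using chord \<open>x \<noteq> e\<close> by (simp_all add: field_simps)
  show "point_add W (Affine x y) (Affine e f) = neg_point W (Affine x y)"
    using \<open>x \<noteq> e\<close> by (simp add: W Let_def slope xx) (simp add: algebra_simps)
  have "- ((l + a1) * x) - (f - l * e) - a3 = - y - a1 * x - a3" using chord by Groebner_Basis.algebra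
  then show "point_add W (Affine e f) (Affine x y) = neg_point W (Affine x y)"
    using \<open>x \<noteq> e\<close> by (simp add: W Let_def slope xx)
qed

section \<open>Cyclic subgroups of order 4\<close>

lemma point_group_simps [simp]:
  "carrier (point_group W) = {P. on_curve W P}"
  "monoid.mult (point_group W) = point_add W" "one (point_group W) = Infinity"
  by (simp_all add: point_group_def)

lemma neg_point_neg_point [simp]: "neg_point W (neg_point W P) = P"
  by (cases W; cases P) simp_all

lemma vertical_gap_neg: "neg_point W (Affine x y) = Affine x z \<Longrightarrow> vertical_gap W x z = - vertical_gap W x y"
proof (cases W)
  case (Weierstrass a1 a2 a3 a4 a6)
  assume "neg_point W (Affine x y) = Affine x z"
  then have z: "z = - y - a1 * x - a3" by (simp add: Weierstrass)
  show ?thesis unfolding Weierstrass vertical_gap.simps z by Groebner_Basis.algebra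
qed

lemma neg_point_affine: obtains z where "neg_point W (Affine x y) = Affine x z"
  by (cases W) simp

lemma neg_point_eq_self_iff: "neg_point W (Affine x y) = Affine x y \<longleftrightarrow> vertical_gap W x y = 0"
proof (cases W)
  case (Weierstrass a1 a2 a3 a4 a6)
  have "2 * y + a1 * x + a3 = y - (- y - a1 * x - a3)" by simp
  then have "2 * y + a1 * x + a3 = 0 \<longleftrightarrow> y = - y - a1 * x - a3" by (simp only: right_minus_eq)
  then show ?thesis by (auto simp: Weierstrass)
qed

lemma point_add_Infinity_right [simp]: "point_add W P Infinity = P"
  by (cases P; cases W) simp_all

lemma on_curve_neg_point [simp]: "on_curve W (neg_point W P) \<longleftrightarrow> on_curve W P"
  by (cases W; cases P) (simp_all add: algebra_simps power2_eq_square)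

text \<open>
  Inverses in the group of points are unique by inspection of the addition law, which suffices to
  evaluate the inverse operation of \<open>point_group\<close>.
\<close>
lemma point_add_eq_Infinity_iff: "point_add W P Q = Infinity \<longleftrightarrow> Q = neg_point W P"
proof (cases W)
  case (Weierstrass a1 a2 a3 a4 a6)
  have eq: "y + z + a1 * x + a3 = 0 \<longleftrightarrow> z = - y - a1 * x - a3" for x y z
  proof -
    have "y + z + a1 * x + a3 = z - (- y - a1 * x - a3)" by simp
    then show ?thesis by (simp only: right_minus_eq)
  qed
  show ?thesis
    by (cases P; cases Q) (auto simp: Weierstrass Let_def eq)
qed

lemma inv_point_group:
  assumes "on_curve W P"
  shows "inv\<^bsub>point_group W\<^esub> P = neg_point W P"
proof -
  have "point_add W P Q = Infinity \<and> point_add W Q P = Infinity \<longleftrightarrow> Q = neg_point W P" for Q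
    by (auto simp: point_add_eq_Infinity_iff)
  then show ?thesis
    unfolding m_inv_def using assms by (intro the_equality) auto
qed

text \<open>
  If the tangent at $P$ met the curve a third time above $x(P)$, it would do so in $P$ itself, so
  the double would be $-P$; being equal to $P$ then makes $\eta$ vanish.
\<close>
lemma double_ne_self:
  assumes "vertical_gap W x y \<noteq> 0"
  shows "point_add W (Affine x y) (Affine x y) \<noteq> Affine x y"
proof
  assume eq: "point_add W (Affine x y) (Affine x y) = Affine x y"
  obtain a1 a2 a3 a4 a6 where W: "W = Weierstrass a1 a2 a3 a4 a6" by (cases W)
  obtain l where "point_add W (Affine x y) (Affine x y) =
       Affine (l^2 + a1 * l - a2 - 2 * x)
         (- ((l + a1) * (l^2 + a1 * l - a2 - 2 * x)) - (y - l * x) - a3)"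
    using point_double[of a1 a2 a3 a4 a6 x y] assms unfolding W by blast
  then have x: "l^2 + a1 * l - a2 - 2 * x = x"
    and y: "- ((l + a1) * (l^2 + a1 * l - a2 - 2 * x)) - (y - l * x) - a3 = y"
    using eq by simp_all
  have "2 * y + a1 * x + a3 = y - (- ((l + a1) * x) - (y - l * x) - a3)" by Groebner_Basis.algebra
  also have "\<dots> = 0" using y by (simp only: x right_minus_eq)
  finally have "2 * y + a1 * x + a3 = 0" .
  then show False using assms by (simp add: W)
qed

text \<open>
  The addition table of $\{O, P, -P, T\}$ follows from \<open>double_at_half\<close>, applied to $P$ and to
  $-P$.
\<close>
lemma generate_point_of_order_4:
  fixes x y e f :: "'a::field_char_0"
  assumes P: "on_curve W (Affine x y)" "vertical_gap W x y \<noteq> 0" and "x \<noteq> e"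
    and e: "two_division W e = 0" "(x - e)^2 = halving_square W e" and f: "vertical_gap W e f = 0"
  shows "generate (point_group W) {Affine x y}
           = {Infinity, Affine x y, neg_point W (Affine x y), Affine e f}" (is "?G = ?S")
proof
  let ?P = "Affine x y" and ?Q = "Affine e f"
  obtain z where z: "neg_point W ?P = Affine x z" by (rule neg_point_affine)
  let ?N = "Affine x z"
  have negN: "neg_point W ?N = ?P" using neg_point_neg_point[of W ?P] z by simp
  have N: "on_curve W ?N" "vertical_gap W x z \<noteq> 0"
    using on_curve_neg_point[of W ?P] P vertical_gap_neg[OF z] by (simp_all only: z neg_equal_0_iff_equal simp_thms)
  have negQ: "neg_point W ?Q = ?Q" using f by (simp add: neg_point_eq_self_iff)
  note table = double_at_half[OF P \<open>x \<noteq> e\<close> e f, unfolded z]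
    double_at_half[OF N \<open>x \<noteq> e\<close> e f, unfolded negN]
  have zero: "point_add W ?P ?N = Infinity" "point_add W ?N ?P = Infinity" "point_add W ?Q ?Q = Infinity"
    using z negN negQ by (simp_all add: point_add_eq_Infinity_iff)
  show "?G \<subseteq> ?S"
  proof
    fix R assume "R \<in> ?G"
    then show "R \<in> ?S"
    proof induction
      case (inv h) then show ?case using inv_point_group[OF P(1)] by simp
    next
      case (eng h1 h2)
      then show ?case unfolding z using table zero by auto
    qed simp_all
  qed
  have "?P \<in> ?G" by (simp add: generate.incl)
  moreover have "?N \<in> ?G"
    using generate.inv[of ?P "{?P}" "point_group W"] inv_point_group[OF P(1)] z by simp
  moreover have "?Q \<in> ?G"
    using generate.eng[OF \<open>?P \<in> ?G\<close> \<open>?P \<in> ?G\<close>] table(1) by simp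
  moreover have "Infinity \<in> ?G" using generate.one[of "point_group W" "{?P}"] by simp
  ultimately show "?S \<subseteq> ?G" unfolding z by simp
qed

lemma generate_subset_if_closed:
  assumes "on_curve W P" "Infinity \<in> S" "P \<in> S" "neg_point W P \<in> S"
    "\<And>A B. A \<in> S \<Longrightarrow> B \<in> S \<Longrightarrow> point_add W A B \<in> S"
  shows "generate (point_group W) {P} \<subseteq> S"
proof
  fix R assume "R \<in> generate (point_group W) {P}"
  then show "R \<in> S"
    by induction (use assms inv_point_group[OF assms(1)] in auto)
qed

text \<open>
  The elements $O, P, -P, 2P$ are distinct: $2P \neq P$ for every $P \neq O$, and any other
  coincidence would make at most three of them closed under addition. So they are the whole group. It also
  contains $-2P = (-P) + (-P)$, and the only one of the four elements that this can be is $2P$.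
  Hence $2P$ has order 2.
\<close>
lemma cyclic_order_4_double:
  assumes P: "on_curve W P" and card: "card (generate (point_group W) {P}) = 4"
  obtains x y e f where "P = Affine x y" "vertical_gap W x y \<noteq> 0"
    "point_add W P P = Affine e f" "vertical_gap W e f = 0"
proof -
  let ?G = "generate (point_group W) {P}"
  have bound: "\<not> ?G \<subseteq> S" if "finite S" "card S \<le> 3" for S
    using card_mono[OF that(1), of ?G] that(2) card by auto
  have "P \<noteq> Infinity"
    using generate_subset_if_closed[of W Infinity "{Infinity}"] bound[of "{Infinity}"] by (auto simp: P)
  then obtain x y where Pxy: "P = Affine x y" by (cases P) auto
  have gap: "vertical_gap W x y \<noteq> 0"
  proof
    assume "vertical_gap W x y = 0"
    then have self: "neg_point W P = P" by (simp add: Pxy neg_point_eq_self_iff)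
    then have "point_add W P P = Infinity" by (simp add: point_add_eq_Infinity_iff)
    then have "?G \<subseteq> {Infinity, P}" using P self by (intro generate_subset_if_closed) auto
    moreover have "card {Infinity, P} \<le> 3" by (simp add: card_insert_if)
    ultimately show False using bound[of "{Infinity, P}"] by simp
  qed
  define N where "N = neg_point W P"
  define D where "D = point_add W P P"
  have negN: "neg_point W N = P" by (simp add: N_def)
  have NP: "N \<noteq> P" using gap by (simp add: N_def Pxy neg_point_eq_self_iff)
  have NN: "point_add W N N = neg_point W D"
    using neg_point_double[OF gap] by (simp add: N_def D_def Pxy)
  have "D \<noteq> Infinity" using NP by (simp add: D_def point_add_eq_Infinity_iff N_def[symmetric])
  have "D \<noteq> P" using double_ne_self[OF gap] by (simp add: D_def Pxy)
  have "D \<noteq> N"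
  proof
    assume DN: "D = N"
    have "?G \<subseteq> {Infinity, P, N}"
    proof (rule generate_subset_if_closed[OF P])
      fix A B assume "A \<in> {Infinity, P, N}" "B \<in> {Infinity, P, N}"
      moreover have "point_add W P P = N" "point_add W N N = P"
        "point_add W P N = Infinity" "point_add W N P = Infinity"
        using DN NN negN by (simp_all add: D_def[symmetric] point_add_eq_Infinity_iff N_def[symmetric])
      ultimately show "point_add W A B \<in> {Infinity, P, N}" by auto
    qed (simp_all add: N_def)
    moreover have "card {Infinity, P, N} \<le> 3" by (simp add: card_insert_if)
    ultimately show False using bound[of "{Infinity, P, N}"] by simp
  qed
  have "P \<in> ?G" by (simp add: generate.incl)
  have "N \<in> ?G"
    using generate.inv[of P "{P}" "point_group W"] inv_point_group[OF P] by (simp add: N_def)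
  have "D \<in> ?G" using generate.eng[OF \<open>P \<in> ?G\<close> \<open>P \<in> ?G\<close>] by (simp add: D_def)
  have "neg_point W D \<in> ?G" using generate.eng[OF \<open>N \<in> ?G\<close> \<open>N \<in> ?G\<close>] by (simp add: NN)
  have "Infinity \<in> ?G" using generate.one[of "point_group W" "{P}"] by simp
  have "N \<noteq> Infinity" by (cases W) (simp add: N_def Pxy)
  have "{Infinity, P, N, D} \<subseteq> ?G"
    using \<open>P \<in> ?G\<close> \<open>N \<in> ?G\<close> \<open>D \<in> ?G\<close> \<open>Infinity \<in> ?G\<close> by simp
  moreover have "card {Infinity, P, N, D} = 4"
    using \<open>P \<noteq> Infinity\<close> NP \<open>D \<noteq> Infinity\<close> \<open>D \<noteq> P\<close> \<open>D \<noteq> N\<close> \<open>N \<noteq> Infinity\<close> by auto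
  ultimately have "?G = {Infinity, P, N, D}"
    using card by (metis card.infinite card_subset_eq zero_neq_numeral)
  obtain e f where Def: "D = Affine e f" using \<open>D \<noteq> Infinity\<close> by (cases D) auto
  have "neg_point W D \<noteq> Infinity" by (cases W) (simp add: Def)
  moreover have "neg_point W D \<noteq> P" using \<open>D \<noteq> N\<close> neg_point_neg_point[of W D] by (auto simp: N_def)
  moreover have "neg_point W D \<noteq> N" using \<open>D \<noteq> P\<close> negN neg_point_neg_point[of W D] by auto
  ultimately have "neg_point W D = D"
    using \<open>neg_point W D \<in> ?G\<close> \<open>?G = {Infinity, P, N, D}\<close> by auto
  then have "vertical_gap W e f = 0" by (simp add: Def neg_point_eq_self_iff)
  moreover have "point_add W P P = Affine e f" using Def by (simp add: D_def)
  ultimately show ?thesis using that[OF Pxy gap] by simp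
qed

text \<open>
  The cyclic group of order 4 generated by a point above \<open>x\<close> whose double lies above \<open>e\<close>. This
  description by $x$-coordinates does not choose a generator, which makes the Galois action and
  intersections of such groups easy to read off.
\<close>
definition halving_subgroup :: "'a::field weierstrass \<Rightarrow> 'a \<Rightarrow> 'a \<Rightarrow> 'a point set" where
  "halving_subgroup W e x = {P. on_curve W P \<and> (\<forall>u v. P = Affine u v \<longrightarrow> u = e \<or> u = x)}"

text \<open>
  For fixed $x$ the equation of the curve is quadratic in $y$ and has the roots $y$ and
  $-y - a_1 x - a_3$.
\<close>
lemma on_curve_same_x_iff:
  fixes x y :: "'a::field_char_0"
  assumes "on_curve W (Affine x y)"
  shows "on_curve W (Affine x z) \<longleftrightarrow> Affine x z = Affine x y \<or> Affine x z = neg_point W (Affine x y)"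
proof -
  obtain a1 a2 a3 a4 a6 where W: "W = Weierstrass a1 a2 a3 a4 a6" by (cases W)
  have "weierstrass_eval W x z - weierstrass_eval W x y = (z - y) * (z - (- y - a1 * x - a3))"
    unfolding W weierstrass_eval.simps by Groebner_Basis.algebra
  then have "on_curve W (Affine x z) \<longleftrightarrow> (z - y) * (z - (- y - a1 * x - a3)) = 0"
    using assms by simp
  also have "\<dots> \<longleftrightarrow> z = y \<or> z = - y - a1 * x - a3" by (simp only: mult_eq_0_iff right_minus_eq)
  finally show ?thesis by (simp add: W)
qed

lemma halving_subgroup_eq:
  fixes x y e f :: "'a::field_char_0"
  assumes "on_curve W (Affine x y)" "on_curve W (Affine e f)" "vertical_gap W e f = 0"
  shows "halving_subgroup W e x = {Infinity, Affine x y, neg_point W (Affine x y), Affine e f}"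
proof (rule Set.set_eqI)
  fix P
  have negQ: "neg_point W (Affine e f) = Affine e f" using assms(3) by (simp add: neg_point_eq_self_iff)
  obtain z where z: "neg_point W (Affine x y) = Affine x z" by (rule neg_point_affine)
  show "P \<in> halving_subgroup W e x \<longleftrightarrow> P \<in> {Infinity, Affine x y, neg_point W (Affine x y), Affine e f}"
  proof (cases P)
    case (Affine u v)
    show ?thesis
      using on_curve_same_x_iff[OF assms(1), of v] on_curve_same_x_iff[OF assms(2), of v]
      unfolding Affine negQ z halving_subgroup_def by auto
  qed (simp add: halving_subgroup_def)
qed

lemma point_with_gap_exists:
  fixes x h :: "'a::field_char_0"
  assumes "h^2 = two_division W x"
  obtains y where "on_curve W (Affine x y)" "vertical_gap W x y = h"
proof -
  obtain a1 a2 a3 a4 a6 where W: "W = Weierstrass a1 a2 a3 a4 a6" by (cases W)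
  have gap: "vertical_gap W x ((h - a1 * x - a3) / 2) = h" by (simp add: W field_simps)
  then have "on_curve W (Affine x ((h - a1 * x - a3) / 2))"
    by (simp only: on_curve_iff assms)
  then show ?thesis using gap by (rule that)
qed

lemma fiber_over_two_torsion:
  fixes e :: "'a::field_char_0"
  assumes "two_division W e = 0"
  obtains f where "\<forall>v. on_curve W (Affine e v) \<longleftrightarrow> v = f"
proof -
  have "0^2 = two_division W e" using assms by simp
  then obtain f where f: "on_curve W (Affine e f)" "vertical_gap W e f = 0"
    by (rule point_with_gap_exists)
  have "neg_point W (Affine e f) = Affine e f" using f(2) by (simp add: neg_point_eq_self_iff)
  then have "\<forall>v. on_curve W (Affine e v) \<longleftrightarrow> v = f"
    unfolding on_curve_same_x_iff[OF f(1)] by simp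
  then show ?thesis by (rule that)
qed

lemma fiber_off_two_torsion:
  fixes x :: "'a::{field_char_0, alg_closed_field}"
  assumes "two_division W x \<noteq> 0"
  obtains y z where "y \<noteq> z" "\<forall>v. on_curve W (Affine x v) \<longleftrightarrow> v = y \<or> v = z"
proof -
  obtain h where h: "h^2 = two_division W x"
    using nth_root_exists[of 2 "two_division W x"] by auto
  then obtain y where y: "on_curve W (Affine x y)" "vertical_gap W x y = h"
    by (rule point_with_gap_exists)
  obtain z where z: "neg_point W (Affine x y) = Affine x z" by (rule neg_point_affine)
  have "vertical_gap W x y \<noteq> 0" using y(2) h assms by auto
  then have "y \<noteq> z" using neg_point_eq_self_iff[of W x y] z by auto
  moreover have "\<forall>v. on_curve W (Affine x v) \<longleftrightarrow> v = y \<or> v = z"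
    unfolding on_curve_same_x_iff[OF y(1)] z by simp
  ultimately show ?thesis by (rule that)
qed

lemma halving_subgroup_generated:
  fixes e x :: "'a::{field_char_0, alg_closed_field}"
  assumes ell: "elliptic_curve W" and e: "two_division W e = 0" "(x - e)^2 = halving_square W e"
  obtains y f where "on_curve W (Affine x y)" "on_curve W (Affine e f)"
    "neg_point W (Affine x y) \<noteq> Affine x y"
    "halving_subgroup W e x = {Infinity, Affine x y, neg_point W (Affine x y), Affine e f}"
    "halving_subgroup W e x = generate (point_group W) {Affine x y}"
    "card (halving_subgroup W e x) = 4"
proof -
  have "x \<noteq> e" and gx: "two_division W x \<noteq> 0"
    using two_division_at_half_nonzero[OF ell e] by auto
  obtain h where "h^2 = two_division W x"
    using nth_root_exists[of 2 "two_division W x"] by auto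
  then obtain y where y: "on_curve W (Affine x y)" "vertical_gap W x y = h"
    by (rule point_with_gap_exists)
  then have gap: "vertical_gap W x y \<noteq> 0" using gx \<open>h^2 = _\<close> by auto
  have "0^2 = two_division W e" using e by simp
  then obtain f where f: "on_curve W (Affine e f)" "vertical_gap W e f = 0"
    by (rule point_with_gap_exists)
  have H: "halving_subgroup W e x = {Infinity, Affine x y, neg_point W (Affine x y), Affine e f}"
    using halving_subgroup_eq[OF y(1) f] .
  obtain z where z: "neg_point W (Affine x y) = Affine x z" by (rule neg_point_affine)
  have ne: "neg_point W (Affine x y) \<noteq> Affine x y" using gap by (simp add: neg_point_eq_self_iff)
  have "card (halving_subgroup W e x) = 4"
    using ne \<open>x \<noteq> e\<close> unfolding H z by simp
  moreover have "halving_subgroup W e x = generate (point_group W) {Affine x y}"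
    using generate_point_of_order_4[OF y(1) gap \<open>x \<noteq> e\<close> e f(2)] H by simp
  ultimately show ?thesis using that y(1) f(1) ne H by metis
qed

text \<open>
  The generator $P$ of a cyclic group of order 4 provides \<open>x\<close>, its double provides \<open>e\<close>.
\<close>
lemma cyclic_subgroup_of_order_4_iff:
  fixes W :: "'a::{field_char_0, alg_closed_field} weierstrass"
  assumes ell: "elliptic_curve W"
  shows "cyclic_subgroup_of_order 4 C (point_group W) \<longleftrightarrow>
    (\<exists>e x. two_division W e = 0 \<and> (x - e)^2 = halving_square W e \<and> C = halving_subgroup W e x)"
proof
  assume "cyclic_subgroup_of_order 4 C (point_group W)"
  then obtain P where P: "on_curve W P" "C = generate (point_group W) {P}" "card C = 4"
    by (auto simp: cyclic_subgroup_of_order_def)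
  then have "card (generate (point_group W) {P}) = 4" by simp
  from cyclic_order_4_double[OF P(1) this] obtain x y e f where
    Pxy: "P = Affine x y" and gap: "vertical_gap W x y \<noteq> 0"
    and D: "point_add W P P = Affine e f" and f: "vertical_gap W e f = 0" .
  have P': "on_curve W (Affine x y)" using P(1) Pxy by simp
  have D': "point_add W (Affine x y) (Affine x y) = Affine e f" using D Pxy by simp
  have e: "two_division W e = 0" "(x - e)^2 = halving_square W e"
    using double_eq_two_torsion[OF P' gap D' f] by auto
  have "x \<noteq> e" using two_division_at_half_nonzero[OF ell e] by auto
  have "on_curve W (Affine e f)" using on_curve_double[OF P' gap] D' by simp
  then have "halving_subgroup W e x = C"
    using halving_subgroup_eq[OF P' _ f] generate_point_of_order_4[OF P' gap \<open>x \<noteq> e\<close> e f]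
    by (simp add: P(2) Pxy)
  with e show "\<exists>e x. two_division W e = 0 \<and> (x - e)^2 = halving_square W e \<and> C = halving_subgroup W e x"
    by blast
next
  assume "\<exists>e x. two_division W e = 0 \<and> (x - e)^2 = halving_square W e \<and> C = halving_subgroup W e x"
  then obtain e x where e: "two_division W e = 0" "(x - e)^2 = halving_square W e"
    and C: "C = halving_subgroup W e x" by blast
  from halving_subgroup_generated[OF ell e] obtain y where
    "on_curve W (Affine x y)" "C = generate (point_group W) {Affine x y}" "card C = 4"
    unfolding C by metis
  then show "cyclic_subgroup_of_order 4 C (point_group W)"
    unfolding cyclic_subgroup_of_order_def by (intro conjI bexI[of _ "Affine x y"]) simp_all
qed

section \<open>Galois-stable cyclic subgroups of order 4\<close>

lemma galois_group_hom:
  assumes "\<sigma> \<in> galois_group"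
  shows "\<sigma> (x + y) = \<sigma> x + \<sigma> y" "\<sigma> (x * y) = \<sigma> x * \<sigma> y" "\<sigma> (to_ac q) = to_ac q" "inj \<sigma>"
    "\<sigma> 0 = 0" "\<sigma> 1 = 1" "\<sigma> (- x) = - \<sigma> x" "\<sigma> (x - y) = \<sigma> x - \<sigma> y" "\<sigma> (x ^ n) = \<sigma> x ^ n"
    "\<sigma> (numeral k) = numeral k"
proof -
  have add: "\<sigma> (x + y) = \<sigma> x + \<sigma> y" and mult: "\<sigma> (x * y) = \<sigma> x * \<sigma> y"
    and base: "\<sigma> (to_ac q) = to_ac q" for x y q
    using assms by (simp_all add: galois_group_def)
  show "\<sigma> (x + y) = \<sigma> x + \<sigma> y" "\<sigma> (x * y) = \<sigma> x * \<sigma> y" "\<sigma> (to_ac q) = to_ac q" by fact+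
  show "inj \<sigma>" using assms by (simp add: galois_group_def bij_def)
  show 0: "\<sigma> 0 = 0" and 1: "\<sigma> 1 = 1" using base[of 0] base[of 1] by simp_all
  show "\<sigma> (numeral k) = numeral k" using base[of "numeral k"] by simp
  have minus: "\<sigma> (- x) = - \<sigma> x" for x using add[of x "- x"] 0 by (simp add: add_eq_0_iff)
  show "\<sigma> (- x) = - \<sigma> x" by (rule minus)
  show "\<sigma> (x - y) = \<sigma> x - \<sigma> y" using add[of x "- y"] minus[of y] by simp
  show "\<sigma> (x ^ n) = \<sigma> x ^ n" by (induction n) (simp_all add: 1 mult)
qed

abbreviation geometric_curve :: "rat weierstrass \<Rightarrow> rat alg_closure weierstrass" where
  "geometric_curve E \<equiv> map_weierstrass to_ac E"

lemma geometric_curve_simps: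
  "two_division (geometric_curve E) (to_ac e) = to_ac (two_division E e)"
  "halving_square (geometric_curve E) (to_ac e) = to_ac (halving_square E e)"
  "elliptic_curve (geometric_curve E) \<longleftrightarrow> elliptic_curve E"
proof -
  obtain a1 a2 a3 a4 a6 where E: "E = Weierstrass a1 a2 a3 a4 a6" by (cases E)
  show "two_division (geometric_curve E) (to_ac e) = to_ac (two_division E e)"
    "halving_square (geometric_curve E) (to_ac e) = to_ac (halving_square E e)"
    by (simp_all add: E)
  have "discriminant (geometric_curve E) = to_ac (discriminant E)" by (simp add: E Let_def)
  then show "elliptic_curve (geometric_curve E) \<longleftrightarrow> elliptic_curve E" by (simp add: elliptic_curve_def)
qed

lemma galois_group_two_division:
  "\<sigma> \<in> galois_group \<Longrightarrow> two_division (geometric_curve E) (\<sigma> x) = \<sigma> (two_division (geometric_curve E) x)"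
  by (cases E) (simp add: galois_group_hom)

lemma galois_group_on_curve:
  assumes "\<sigma> \<in> galois_group" "on_curve (geometric_curve E) P"
  shows "on_curve (geometric_curve E) (map_point \<sigma> P)"
proof (cases P)
  case (Affine x y)
  have "weierstrass_eval (geometric_curve E) (\<sigma> x) (\<sigma> y) = \<sigma> (weierstrass_eval (geometric_curve E) x y)"
    by (cases E) (simp add: galois_group_hom[OF assms(1)])
  then show ?thesis using assms(2) by (simp add: Affine galois_group_hom[OF assms(1)])
qed simp

text \<open>
  An automorphism that preserves the group maps the points above \<open>e\<close> and \<open>x\<close> to points of
  the group, so it permutes \<open>{e, x}\<close>.
  It cannot exchange them because \<open>e\<close> is a root of $g$ and \<open>x\<close> is not. So
  stability under all automorphisms means that both numbers are rational.
\<close>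
lemma galois_stable_halving_subgroup_iff:
  assumes ell: "elliptic_curve E"
    and e: "two_division (geometric_curve E) e = 0" "(x - e)^2 = halving_square (geometric_curve E) e"
  shows "galois_stable (halving_subgroup (geometric_curve E) e x) \<longleftrightarrow> e \<in> range to_ac \<and> x \<in> range to_ac"
proof -
  let ?W = "geometric_curve E"
  let ?H = "halving_subgroup ?W e x"
  have ellW: "elliptic_curve ?W" using ell by (simp add: geometric_curve_simps)
  obtain y f where y: "on_curve ?W (Affine x y)" and f: "on_curve ?W (Affine e f)"
    and card: "card ?H = 4"
    using halving_subgroup_generated[OF ellW e] by metis
  have mem: "Affine x y \<in> ?H" "Affine e f \<in> ?H" using y f by (auto simp: halving_subgroup_def)
  have gx: "two_division ?W x \<noteq> 0" using two_division_at_half_nonzero[OF ellW e] by auto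
  show ?thesis
  proof
    assume stable: "galois_stable ?H"
    have "\<sigma> e = e \<and> \<sigma> x = x" if \<sigma>: "\<sigma> \<in> galois_group" for \<sigma>
    proof -
      have "map_point \<sigma> (Affine x y) \<in> ?H" "map_point \<sigma> (Affine e f) \<in> ?H"
        using stable \<sigma> mem unfolding galois_stable_def by blast+
      then have "\<sigma> x = e \<or> \<sigma> x = x" "\<sigma> e = e \<or> \<sigma> e = x"
        by (simp_all add: halving_subgroup_def)
      moreover have "two_division ?W (\<sigma> x) \<noteq> 0"
        using gx galois_group_hom(4)[OF \<sigma>] galois_group_hom(5)[OF \<sigma>]
        by (metis galois_group_two_division[OF \<sigma>] injD)
      moreover have "two_division ?W (\<sigma> e) = 0"
        using e by (simp add: galois_group_two_division[OF \<sigma>] galois_group_hom[OF \<sigma>])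
      ultimately show ?thesis using e(1) gx by auto
    qed
    then show "e \<in> range to_ac \<and> x \<in> range to_ac"
      using fixed_by_galois_group_iff by blast
  next
    assume "e \<in> range to_ac \<and> x \<in> range to_ac"
    show "galois_stable ?H"
      unfolding galois_stable_def
    proof
      fix \<sigma> assume \<sigma>: "\<sigma> \<in> galois_group"
      have fixed: "\<sigma> e = e" "\<sigma> x = x"
        using \<open>e \<in> range to_ac \<and> x \<in> range to_ac\<close> galois_group_hom(3)[OF \<sigma>] by auto
      have "map_point \<sigma> ` ?H \<subseteq> ?H"
      proof
        fix Q assume "Q \<in> map_point \<sigma> ` ?H"
        then obtain P where P: "P \<in> ?H" "Q = map_point \<sigma> P" by blast
        then show "Q \<in> ?H"
          using galois_group_on_curve[OF \<sigma>, of E P] fixed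
          by (cases P) (auto simp: halving_subgroup_def)
      qed
      moreover have "inj (map_point \<sigma>)" using galois_group_hom(4)[OF \<sigma>] by (rule point.inj_map)
      moreover have "finite ?H" using card by (metis card.infinite zero_neq_numeral)
      ultimately show "map_point \<sigma> ` ?H = ?H" by (meson endo_inj_surj inj_on_subset subset_UNIV)
    qed
  qed
qed

abbreviation rational_halving_subgroup :: "rat weierstrass \<Rightarrow> rat \<Rightarrow> rat \<Rightarrow> rat alg_closure point set" where
  "rational_halving_subgroup E e x \<equiv> halving_subgroup (geometric_curve E) (to_ac e) (to_ac x)"

lemma stable_cyclic4_iff:
  assumes ell: "elliptic_curve E"
  shows "stable_cyclic4 E C \<longleftrightarrow>
    (\<exists>e x. two_division E e = 0 \<and> (x - e)^2 = halving_square E e \<and> C = rational_halving_subgroup E e x)"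
proof -
  let ?W = "geometric_curve E"
  have ellW: "elliptic_curve ?W" using ell by (simp add: geometric_curve_simps)
  have rational: "two_division ?W (to_ac e) = 0 \<longleftrightarrow> two_division E e = 0"
    "(to_ac x - to_ac e)^2 = halving_square ?W (to_ac e) \<longleftrightarrow> (x - e)^2 = halving_square E e" for e x
    by (simp_all add: geometric_curve_simps flip: to_ac_diff to_ac_power)
  show ?thesis
  proof
    assume "stable_cyclic4 E C"
    then have cyc: "cyclic_subgroup_of_order 4 C (point_group ?W)" and stable: "galois_stable C"
      by (simp_all add: stable_cyclic4_def geometric_points_def)
    from cyc obtain e x where ex: "two_division ?W e = 0" "(x - e)^2 = halving_square ?W e"
      and C: "C = halving_subgroup ?W e x"
      unfolding cyclic_subgroup_of_order_4_iff[OF ellW] by blast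
    from stable obtain e' x' where "e = to_ac e'" "x = to_ac x'"
      unfolding C galois_stable_halving_subgroup_iff[OF ell ex] by blast
    with ex C rational
    show "\<exists>e x. two_division E e = 0 \<and> (x - e)^2 = halving_square E e \<and> C = rational_halving_subgroup E e x"
      by blast
  next
    assume "\<exists>e x. two_division E e = 0 \<and> (x - e)^2 = halving_square E e \<and> C = rational_halving_subgroup E e x"
    then obtain e x where ex: "two_division E e = 0" "(x - e)^2 = halving_square E e"
      and C: "C = rational_halving_subgroup E e x" by blast
    have ex': "two_division ?W (to_ac e) = 0" "(to_ac x - to_ac e)^2 = halving_square ?W (to_ac e)"
      using ex rational by auto
    have "galois_stable C"
      unfolding C galois_stable_halving_subgroup_iff[OF ell ex'] by blast
    moreover have "cyclic_subgroup_of_order 4 C (point_group ?W)"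
      unfolding cyclic_subgroup_of_order_4_iff[OF ellW] using ex' C by blast
    ultimately show "stable_cyclic4 E C" by (simp add: stable_cyclic4_def geometric_points_def)
  qed
qed

section \<open>Pairs of Galois-stable cyclic subgroups\<close>

text \<open>
  The $x$-coordinates of those rational points of order 2 that lie below a pair of stable cyclic
  groups of order 4.
\<close>
definition square_two_torsion :: "rat weierstrass \<Rightarrow> rat set" where
  "square_two_torsion E = {e. two_division E e = 0 \<and> (\<exists>s. s^2 = halving_square E e)}"

definition halving_pair :: "rat weierstrass \<Rightarrow> rat \<Rightarrow> rat alg_closure point set set" where
  "halving_pair E e = rational_halving_subgroup E e ` {x. (x - e)^2 = halving_square E e}"

context
  fixes E :: "rat weierstrass"
  assumes ell: "elliptic_curve E"
begin

text \<open>
  Above \<open>e\<close> there is one point, above \<open>x\<close> there are two. If \<open>e\<close> and \<open>e'\<close> differ, the groups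
  can share no abscissa except \<open>x = x'\<close>, so their intersection has one or at least three
  elements.
\<close>
lemma same_two_torsion_if_card_Int_2:
  assumes e: "two_division E e = 0" "(x - e)^2 = halving_square E e"
    and e': "two_division E e' = 0" "(x' - e')^2 = halving_square E e'"
    and card: "card (rational_halving_subgroup E e x \<inter> rational_halving_subgroup E e' x') = 2"
  shows "e = e'"
proof (rule ccontr)
  assume "e \<noteq> e'"
  let ?I = "rational_halving_subgroup E e x \<inter> rational_halving_subgroup E e' x'"
  have gx: "two_division E x \<noteq> 0" and gx': "two_division E x' \<noteq> 0"
    using two_division_at_half_nonzero(1)[OF ell e] two_division_at_half_nonzero(1)[OF ell e'] .
  then have "two_division (geometric_curve E) (to_ac x) \<noteq> 0" by (simp add: geometric_curve_simps)
  then obtain y z where yz: "y \<noteq> z"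
    and fiber: "\<forall>v. on_curve (geometric_curve E) (Affine (to_ac x) v) \<longleftrightarrow> v = y \<or> v = z"
    by (rule fiber_off_two_torsion)
  have on: "on_curve (geometric_curve E) (Affine (to_ac x) y)"
    "on_curve (geometric_curve E) (Affine (to_ac x) z)"
    using fiber by (simp_all del: on_curve.simps)
  have ne: "e \<noteq> x'" "x \<noteq> e'" using e e' gx gx' by auto
  have "?I \<subseteq> {Infinity}" if "x \<noteq> x'"
  proof
    fix P assume "P \<in> ?I"
    then show "P \<in> {Infinity}"
      using that ne \<open>e \<noteq> e'\<close> by (cases P) (auto simp: halving_subgroup_def)
  qed
  then have "x = x'" using card card_mono[of "{Infinity}" ?I] by force
  then have "{Infinity, Affine (to_ac x) y, Affine (to_ac x) z} \<subseteq> ?I"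
    using on by (simp add: halving_subgroup_def del: on_curve.simps(2))
  moreover have "finite ?I" using card by (metis card.infinite zero_neq_numeral)
  ultimately have "card {Infinity, Affine (to_ac x) y, Affine (to_ac x) z} \<le> 2"
    using card card_mono by metis
  then show False using yz(1) by simp
qed

lemma card_Int_two_halves:
  assumes e: "two_division E e = 0" "(x - e)^2 = halving_square E e"
    and e': "(x' - e)^2 = halving_square E e" and "x \<noteq> x'"
  shows "card (rational_halving_subgroup E e x \<inter> rational_halving_subgroup E e x') = 2"
    "rational_halving_subgroup E e x \<noteq> rational_halving_subgroup E e x'"
proof -
  let ?H = "rational_halving_subgroup E e"
  let ?W = "geometric_curve E"
  have gx: "two_division E x \<noteq> 0" and "x \<noteq> e"
    using two_division_at_half_nonzero[OF ell e] .
  have "two_division ?W (to_ac x) \<noteq> 0" using gx by (simp add: geometric_curve_simps)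
  then obtain y z where "y \<noteq> z" "\<forall>v. on_curve ?W (Affine (to_ac x) v) \<longleftrightarrow> v = y \<or> v = z"
    by (rule fiber_off_two_torsion)
  then have y: "on_curve ?W (Affine (to_ac x) y)" by (simp del: on_curve.simps)
  have "two_division ?W (to_ac e) = 0" using e(1) by (simp add: geometric_curve_simps)
  then obtain f where f: "\<forall>v. on_curve ?W (Affine (to_ac e) v) \<longleftrightarrow> v = f"
    by (rule fiber_over_two_torsion)
  have "?H x \<inter> ?H x' = {Infinity, Affine (to_ac e) f}"
  proof (rule Set.set_eqI)
    fix P show "P \<in> ?H x \<inter> ?H x' \<longleftrightarrow> P \<in> {Infinity, Affine (to_ac e) f}"
    proof (cases P)
      case (Affine u v)
      have "P \<in> ?H x \<inter> ?H x' \<longleftrightarrow>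
          on_curve ?W (Affine u v) \<and> (u = to_ac e \<or> u = to_ac x) \<and> (u = to_ac e \<or> u = to_ac x')"
        unfolding Affine halving_subgroup_def by blast
      also have "(u = to_ac e \<or> u = to_ac x) \<and> (u = to_ac e \<or> u = to_ac x') \<longleftrightarrow> u = to_ac e"
        using \<open>x \<noteq> x'\<close> to_ac_eq_iff by metis
      also have "on_curve ?W (Affine u v) \<and> u = to_ac e \<longleftrightarrow> u = to_ac e \<and> v = f"
        using f by metis
      finally show ?thesis by (simp add: Affine)
    qed (simp add: halving_subgroup_def)
  qed
  then show "card (?H x \<inter> ?H x') = 2" by simp
  have "Affine (to_ac x) y \<in> ?H x" "Affine (to_ac x) y \<notin> ?H x'"
    using y \<open>x \<noteq> x'\<close> \<open>x \<noteq> e\<close> by (auto simp: halving_subgroup_def simp del: on_curve.simps(2))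
  then show "?H x \<noteq> ?H x'" by blast
qed

lemma halving_pair_eq:
  assumes e: "two_division E e = 0" and s: "s^2 = halving_square E e"
  shows "halving_pair E e = {rational_halving_subgroup E e (e + s), rational_halving_subgroup E e (e - s)}"
proof -
  have "{x. (x - e)^2 = halving_square E e} = {e + s, e - s}"
  proof (rule Set.set_eqI)
    fix x
    have "(x - e)^2 = halving_square E e \<longleftrightarrow> x - e = s \<or> x - e = - s"
      by (simp only: s[symmetric] power2_eq_iff)
    also have "x - e = s \<longleftrightarrow> x = e + s" by (simp only: diff_eq_eq add.commute)
    also have "x - e = - s \<longleftrightarrow> x = e - s" by auto
    finally show "x \<in> {x. (x - e)^2 = halving_square E e} \<longleftrightarrow> x \<in> {e + s, e - s}" by simp
  qed
  then show ?thesis by (simp only: halving_pair_def image_insert image_empty)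
qed

text \<open>
  The two groups of a pair contain the same point of order 2, hence they belong to the two square
  roots of the same number \<open>halving_square E e\<close>. These square roots are distinct, because an
  elliptic curve has no double root of $g$.
\<close>
lemma stable_cyclic4_pairs_eq: "stable_cyclic4_pairs E = halving_pair E ` square_two_torsion E"
proof (intro equalityI subsetI)
  fix S assume "S \<in> stable_cyclic4_pairs E"
  then obtain C D where S: "S = {C, D}" and "stable_cyclic4 E C" "stable_cyclic4 E D"
    and ne: "C \<noteq> D" and card: "card (C \<inter> D) = 2"
    by (auto simp: stable_cyclic4_pairs_def)
  then obtain e x e' x' where e: "two_division E e = 0" "(x - e)^2 = halving_square E e"
    and C: "C = rational_halving_subgroup E e x"
    and e': "two_division E e' = 0" "(x' - e')^2 = halving_square E e'"
    and D: "D = rational_halving_subgroup E e' x'"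
    unfolding stable_cyclic4_iff[OF ell] by blast
  have "e = e'" using same_two_torsion_if_card_Int_2[OF e e'] card by (simp add: C D)
  have "x \<noteq> x'" using ne by (auto simp: C D \<open>e = e'\<close>)
  have "(x' - e)^2 = (x - e)^2" using e e' \<open>e = e'\<close> by simp
  then have "x' - e = x - e \<or> x' - e = - (x - e)" by (simp only: power2_eq_iff)
  then have x': "x' = e - (x - e)" using \<open>x \<noteq> x'\<close> by auto
  have "S = halving_pair E e"
    using halving_pair_eq[OF e] by (simp add: S C D x' flip: \<open>e = e'\<close>)
  moreover have "e \<in> square_two_torsion E" using e by (auto simp: square_two_torsion_def)
  ultimately show "S \<in> halving_pair E ` square_two_torsion E" by blast
next
  fix S assume "S \<in> halving_pair E ` square_two_torsion E"
  then obtain e s where e: "two_division E e = 0" and s: "s^2 = halving_square E e"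
    and S: "S = halving_pair E e"
    by (auto simp: square_two_torsion_def)
  have "s \<noteq> 0" using elliptic_curve_no_double_root[OF ell e] s by auto
  then have ne: "e + s \<noteq> e - s" by simp
  have sq: "(e + s - e)^2 = halving_square E e" "(e - s - e)^2 = halving_square E e"
    using s by simp_all
  have "stable_cyclic4 E (rational_halving_subgroup E e (e + s))"
    "stable_cyclic4 E (rational_halving_subgroup E e (e - s))"
    unfolding stable_cyclic4_iff[OF ell] using e sq by blast+
  then show "S \<in> stable_cyclic4_pairs E"
    using card_Int_two_halves[OF e sq ne]
    unfolding S halving_pair_eq[OF e s] stable_cyclic4_pairs_def by blast
qed

text \<open>
  The point of order 2 above \<open>e\<close> lies in every group of the pair, and it is the only point of
  order 2 there.
\<close>
lemma inj_on_halving_pair: "inj_on (halving_pair E) (square_two_torsion E)"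
proof (rule inj_onI)
  fix e e' assume "e \<in> square_two_torsion E" "e' \<in> square_two_torsion E"
    and eq: "halving_pair E e = halving_pair E e'"
  then obtain s s' where e: "two_division E e = 0" "s^2 = halving_square E e"
    and e': "two_division E e' = 0" "s'^2 = halving_square E e'"
    by (auto simp: square_two_torsion_def)
  have "rational_halving_subgroup E e (e + s) \<in> halving_pair E e'"
    unfolding eq[symmetric] halving_pair_eq[OF e] by simp
  then obtain x' where x': "(x' - e')^2 = halving_square E e'"
    and H: "rational_halving_subgroup E e (e + s) = rational_halving_subgroup E e' x'"
    by (auto simp: halving_pair_def)
  have "two_division (geometric_curve E) (to_ac e) = 0"
    using e(1) by (simp add: geometric_curve_simps)
  then obtain f where "\<forall>v. on_curve (geometric_curve E) (Affine (to_ac e) v) \<longleftrightarrow> v = f"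
    by (rule fiber_over_two_torsion)
  then have f: "on_curve (geometric_curve E) (Affine (to_ac e) f)" by (simp del: on_curve.simps)
  have gx': "two_division E x' \<noteq> 0"
    using two_division_at_half_nonzero(1)[OF ell e'(1) x'] .
  have "Affine (to_ac e) f \<in> rational_halving_subgroup E e' x'"
    unfolding H[symmetric] using f by (auto simp: halving_subgroup_def simp del: on_curve.simps(2))
  then have "e = e' \<or> e = x'" by (simp add: halving_subgroup_def)
  then show "e = e'" using gx' e(1) by auto
qed

lemma card_stable_cyclic4_pairs: "card (stable_cyclic4_pairs E) = card (square_two_torsion E)"
  unfolding stable_cyclic4_pairs_eq by (rule card_image[OF inj_on_halving_pair])

end

section \<open>Curves with rational 2-torsion\<close>

text \<open>
  For the cubic $g$ with leading coefficient 4, Taylor's formula gives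
  $g(e + 1) - g(e - 1) = 2 g'(e) + 8$. It recovers $g'(e)$ from the values of $g$ alone,
  whatever expression for $g$ is known.
\<close>
lemma halving_square_as_difference:
  fixes e :: "'a::field_char_0"
  shows "8 * halving_square W e = two_division W (e + 1) - two_division W (e - 1) - 8"
proof (cases W)
  case (Weierstrass a1 a2 a3 a4 a6)
  have "8 * halving_square W e = 24 * e^2 + 4 * (a1^2 + 4 * a2) * e + 4 * (2 * a4 + a1 * a3)"
    by (simp add: Weierstrass field_simps)
  also have "\<dots> = two_division W (e + 1) - two_division W (e - 1) - 8"
    unfolding Weierstrass two_division.simps by Groebner_Basis.algebra
  finally show ?thesis .
qed

text \<open>
  Equality of values instead of coefficients; over an infinite field this is the factorisation of
  the polynomial $g$.
\<close>
definition splits_with_roots :: "'a::field weierstrass \<Rightarrow> 'a \<Rightarrow> 'a \<Rightarrow> 'a \<Rightarrow> bool" where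
  "splits_with_roots W a b c \<longleftrightarrow> (\<forall>z. two_division W z = 4 * (z - a) * (z - b) * (z - c))"

lemma splits_with_roots_permute:
  "splits_with_roots W a b c \<Longrightarrow> splits_with_roots W b a c"
  "splits_with_roots W a b c \<Longrightarrow> splits_with_roots W c b a"
proof -
  have "4 * (z - a) * (z - b) * (z - c) = 4 * (z - b) * (z - a) * (z - c)"
    and "4 * (z - a) * (z - b) * (z - c) = 4 * (z - c) * (z - b) * (z - a)" for z
    by (simp_all only: mult.commute mult.left_commute)
  note eq = this
  show "splits_with_roots W b a c" if "splits_with_roots W a b c"
    using that unfolding splits_with_roots_def eq(1) .
  show "splits_with_roots W c b a" if "splits_with_roots W a b c"
    using that unfolding splits_with_roots_def eq(2) .
qed

lemma splits_with_roots_eq_0_iff: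
  fixes a :: "'a::field_char_0"
  shows "splits_with_roots W a b c \<Longrightarrow> two_division W z = 0 \<longleftrightarrow> z = a \<or> z = b \<or> z = c"
  by (simp add: splits_with_roots_def)

lemma halving_square_at_root:
  fixes a :: "'a::field_char_0"
  assumes "splits_with_roots W a b c"
  shows "halving_square W a = (a - b) * (a - c)"
proof -
  have "8 * halving_square W a = 4 * (a + 1 - a) * (a + 1 - b) * (a + 1 - c)
          - 4 * (a - 1 - a) * (a - 1 - b) * (a - 1 - c) - 8"
    using assms by (simp add: halving_square_as_difference splits_with_roots_def)
  also have "\<dots> = 8 * ((a - b) * (a - c))" by Groebner_Basis.algebra
  finally show ?thesis by simp
qed

lemma splits_if_two_roots:
  fixes p q :: "'a::field_char_0"
  assumes "two_division W p = 0" "two_division W q = 0" "p \<noteq> q"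
  obtains t where "splits_with_roots W p q t"
proof -
  obtain a1 a2 a3 a4 a6 where W: "W = Weierstrass a1 a2 a3 a4 a6" by (cases W)
  define b2 b4 b6 where "b2 = a1^2 + 4 * a2" and "b4 = 2 * (2 * a4 + a1 * a3)" and "b6 = a3^2 + 4 * a6"
  have g: "two_division W z = 4 * z^3 + b2 * z^2 + b4 * z + b6" for z
    by (simp add: W b2_def b4_def b6_def)
  \<comment> \<open>The sum of the three roots is $-b_2/4$.\<close>
  define t where "t = - b2 / 4 - p - q"
  have b2: "b2 = - 4 * (t + p + q)" by (simp add: t_def)
  have "(p - q) * (4 * (p^2 + p * q + q^2) + b2 * (p + q) + b4) = two_division W p - two_division W q"
    unfolding g by Groebner_Basis.algebra
  then have "4 * (p^2 + p * q + q^2) + b2 * (p + q) + b4 = 0" using assms by simp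
  then have b4: "b4 = - 4 * (p^2 + p * q + q^2) - b2 * (p + q)" by Groebner_Basis.algebra
  have b6: "b6 = - (4 * p^3 + b2 * p^2 + b4 * p)" using assms(1)[unfolded g] by Groebner_Basis.algebra
  have "two_division W z = 4 * (z - p) * (z - q) * (z - t)" for z
    unfolding g b6 b4 b2 by Groebner_Basis.algebra
  then show ?thesis using that[of t] by (simp add: splits_with_roots_def)
qed

text \<open>
  At the middle root $g'/4$ is negative and therefore not a square.
\<close>
lemma square_two_torsion_of_split:
  assumes split: "splits_with_roots E a b c" and "a < b" "b < c"
    and sq: "(b - a) * (c - a) = s^2" "(c - a) * (c - b) = t^2"
  shows "square_two_torsion E = {a, c}"
proof -
  have "halving_square E a = s^2"
    unfolding halving_square_at_root[OF split] sq(1)[symmetric] by Groebner_Basis.algebra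
  moreover have "halving_square E c = t^2"
    unfolding halving_square_at_root[OF splits_with_roots_permute(2)[OF split]] sq(2)[symmetric]
    by Groebner_Basis.algebra
  moreover have "halving_square E b < 0"
    using assms(2,3) unfolding halving_square_at_root[OF splits_with_roots_permute(1)[OF split]]
    by (simp add: mult_less_0_iff)
  then have "s^2 \<noteq> halving_square E b" for s using zero_le_power2[of s] by linarith
  ultimately show ?thesis
    unfolding square_two_torsion_def splits_with_roots_eq_0_iff[OF split] by auto
qed

lemma splits_with_roots_unique:
  fixes a :: "'a::linordered_field"
  assumes "splits_with_roots W a b c" "a < b" "b < c" "splits_with_roots W a' b' c'" "a' < b'" "b' < c'"
  shows "a = a'" "b = b'" "c = c'"
proof -
  have "{a, b, c} = {a', b', c'}"
    using splits_with_roots_eq_0_iff[OF assms(1)] splits_with_roots_eq_0_iff[OF assms(4)] by blast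
  moreover have "Min {a, b, c} = a" "Max {a, b, c} = c" "Min {a', b', c'} = a'" "Max {a', b', c'} = c'"
    using assms by auto
  ultimately show "a = a'" "c = c'" by metis+
  then show "b = b'" using \<open>{a, b, c} = {a', b', c'}\<close> assms by auto
qed

section \<open>Squarefree parts and rational points of the circle\<close>

text \<open>
  The multiplicity of a prime in a squarefree \<open>r\<close> is 0 or 1, so it equals the parity of its
  multiplicity in \<open>r * a^2\<close>.
\<close>
lemma squarefree_eq_if_quotient_square:
  fixes r r' :: int and u u' :: rat
  assumes "0 < r" "squarefree r" "0 < r'" "squarefree r'" "u \<noteq> 0" "u' \<noteq> 0"
    and eq: "u^2 * of_int r = u'^2 * of_int r'"
  shows "r = r'"
proof -
  obtain a b where ab: "u / u' = of_int a / of_int b" "b > 0"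
    by (metis quotient_of_denom_pos quotient_of_div surj_pair)
  have nz: "a \<noteq> 0" "b \<noteq> 0" using ab assms by auto
  have "(u / u')^2 * of_int r = of_int r'" using eq assms by (simp add: field_simps)
  then have "of_int (r * a^2) = (of_int (r' * b^2) :: rat)" using nz by (simp add: ab field_simps)
  then have key: "r * a^2 = r' * b^2" by (simp only: of_int_eq_iff)
  have mult: "multiplicity p r = multiplicity p (r * a^2) mod 2"
    if "prime p" "squarefree r" "r \<noteq> 0" "a \<noteq> 0" for p r a :: int
  proof -
    have "multiplicity p r \<le> 1" using that by (simp add: squarefree_factorial_semiring'')
    moreover have "multiplicity p (r * a^2) = multiplicity p r + 2 * multiplicity p a"
    proof -
      have "comm_semiring_1_class.prime_elem p" using that(1) by (rule prime_imp_prime_elem)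
      then show ?thesis
        using that prime_elem_multiplicity_mult_distrib[of p r "a^2"]
          prime_elem_multiplicity_power_distrib[of p a 2] by simp
    qed
    ultimately show ?thesis by simp
  qed
  have "multiplicity p r = multiplicity p r'" if "prime p" for p
    using mult[OF that assms(2) _ nz(1)] mult[OF that assms(4) _ nz(2)] assms key by simp
  then have "normalize r = normalize r'" using assms by (intro multiplicity_eq_imp_eq) auto
  then show ?thesis using assms by simp
qed

lemma squarefree_times_square_exists:
  fixes R :: rat
  assumes "0 < R"
  obtains r :: int and u :: rat where "0 < r" "squarefree r" "u \<noteq> 0" "R = u^2 * of_int r"
proof -
  obtain a b where ab: "R = of_int a / of_int b" "b > 0"
    by (metis quotient_of_denom_pos quotient_of_div surj_pair)
  then have "a > 0" using assms by (simp add: zero_less_divide_iff)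
  define n where "n = a * b"
  have "n > 0" using ab \<open>a > 0\<close> by (simp add: n_def)
  have n: "n = squarefree_part n * square_part n ^ 2" by (rule squarefree_decompose)
  with \<open>n > 0\<close> have pos: "0 < squarefree_part n" by (metis zero_less_mult_pos2 zero_less_power2 mult_zero_right power_zero_numeral)
  \<comment> \<open>Multiplying by the denominator makes $R$ an integer divided by a square.\<close>
  have "R = of_int n / of_int b ^ 2" using ab by (simp add: n_def field_simps power2_eq_square)
  also have "\<dots> = (of_int (square_part n) / of_int b)^2 * of_int (squarefree_part n)"
    by (subst n) (simp add: power_divide)
  finally show ?thesis
    using \<open>n > 0\<close> ab(2) pos by (intro that[of "squarefree_part n" "of_int (square_part n) / of_int b"]) auto
qed

text \<open>
  The abscissa of the point $((1 - \tau^2)/(1 + \tau^2),\ 2\tau/(1 + \tau^2))$ of the unit circle.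
\<close>
definition circle_cos :: "rat \<Rightarrow> rat" where
  "circle_cos \<tau> = (1 - \<tau>^2) / (1 + \<tau>^2)"

lemma circle_cos_bounds:
  assumes "0 < \<tau>" "\<tau> < 1"
  shows "0 < circle_cos \<tau>" "circle_cos \<tau> < 1"
proof -
  have sq: "0 < \<tau>^2" "\<tau>^2 < 1" using assms by (simp_all add: power_less_one_iff)
  then have "0 < 1 + \<tau>^2" by linarith
  with sq show "0 < circle_cos \<tau>" "circle_cos \<tau> < 1"
    by (simp_all add: circle_cos_def divide_less_eq_1 zero_less_divide_iff)
qed

lemma circle_cos_inject:
  assumes "0 < \<tau>" "0 < \<tau>'" "circle_cos \<tau> = circle_cos \<tau>'"
  shows "\<tau> = \<tau>'"
proof -
  have "0 < 1 + \<tau>^2" "0 < 1 + \<tau>'^2" by (simp_all add: add_pos_nonneg)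
  then have "(1 - \<tau>^2) * (1 + \<tau>'^2) = (1 - \<tau>'^2) * (1 + \<tau>^2)"
    using assms(3) by (simp add: circle_cos_def field_simps)
  then have "\<tau>^2 = \<tau>'^2" by (simp add: algebra_simps)
  then show ?thesis using assms by (simp add: power2_eq_iff)
qed

lemma one_minus_circle_cos_square:
  "1 - (circle_cos \<tau>)^2 = (2 * \<tau> / (1 + \<tau>^2))^2"
proof -
  have "0 < 1 + \<tau>^2" by (simp add: add_pos_nonneg)
  then have nz: "1 + \<tau>^2 \<noteq> 0" by simp
  have "1 - (circle_cos \<tau>)^2 = 1 - (1 - \<tau>^2)^2 / (1 + \<tau>^2)^2"
    by (simp only: circle_cos_def power_divide)
  also have "\<dots> = ((1 + \<tau>^2)^2 - (1 - \<tau>^2)^2) / (1 + \<tau>^2)^2"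
    by (subst diff_divide_distrib) (use nz in simp)
  also have "(1 + \<tau>^2)^2 - (1 - \<tau>^2)^2 = (2 * \<tau>)^2" by Groebner_Basis.algebra
  finally show ?thesis by (simp add: power_divide)
qed

lemma circle_point_is_circle_cos:
  assumes "0 < c" "0 < d" "c^2 + d^2 = 1"
  obtains \<tau> where "0 < \<tau>" "\<tau> < 1" "circle_cos \<tau> = c"
proof (rule that)
  \<comment> \<open>The slope of the line through $(-1, 0)$ and $(c, d)$.\<close>
  define \<tau> where "\<tau> = d / (1 + c)"
  have d: "d^2 = (1 - c) * (1 + c)" using assms(3) by (simp add: algebra_simps power2_eq_square)
  have "\<tau>^2 = (1 - c) * (1 + c) / (1 + c)^2" by (simp only: \<tau>_def power_divide d)
  also have "\<dots> = (1 - c) / (1 + c)" using assms(1) by (simp add: power2_eq_square)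
  finally have sq: "\<tau>^2 = (1 - c) / (1 + c)" .
  show "0 < \<tau>" using assms by (simp add: \<tau>_def)
  have "\<tau>^2 < 1" using assms by (simp add: sq)
  then show "\<tau> < 1" by (metis linorder_not_le one_le_power)
  have "1 - \<tau>^2 = 2 * c / (1 + c)" "1 + \<tau>^2 = 2 / (1 + c)"
    using assms(1) by (simp_all add: sq field_simps)
  then show "circle_cos \<tau> = c" using assms(1) by (simp add: circle_cos_def)
qed

section \<open>Models\<close>

text \<open>
  The parameters $s$ and $t$ of a change of variables only serve to transform $\eta$ into
  $u^3 \eta$, and they can always be chosen to do so. What remains is the condition on $g$.
\<close>
lemma isomorphic_over_rat_iff:
  "isomorphic_over_rat W W' \<longleftrightarrow>
     (\<exists>u r. u \<noteq> 0 \<and> (\<forall>x. two_division W (u^2 * x + r) = u^6 * two_division W' x))"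
proof -
  obtain a1 a2 a3 a4 a6 where W: "W = Weierstrass a1 a2 a3 a4 a6" by (cases W)
  obtain c1 c2 c3 c4 c6 where W': "W' = Weierstrass c1 c2 c3 c4 c6" by (cases W')
  have eval: "weierstrass_eval V x y = ((vertical_gap V x y)^2 - two_division V x) / 4" for V x and y :: rat
    by (simp add: vertical_gap_square)
  show ?thesis
  proof
    assume "isomorphic_over_rat W W'"
    then obtain u r s t where "u \<noteq> 0"
      and iso: "\<And>x y. weierstrass_eval W (u^2 * x + r) (u^3 * y + u^2 * s * x + t) = u^6 * weierstrass_eval W' x y"
      unfolding isomorphic_over_rat_def by blast
    have "two_division W (u^2 * x + r) = u^6 * two_division W' x" for x
    proof -
      define x' where "x' = u^2 * x + r"
      define k where "k = u^2 * s * x + t"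
      have iso': "weierstrass_eval W x' (u^3 * y + k) = u^6 * weierstrass_eval W' x y" for y
        using iso[of x y] by (simp add: x'_def k_def add.assoc)
      \<comment> \<open>The equation is quadratic in $y$; the difference of its values at $y = 1$ and $y = -1$ is
        twice its linear coefficient.\<close>
      have "2 * u^3 * vertical_gap W x' k
          = weierstrass_eval W x' (u^3 * 1 + k) - weierstrass_eval W x' (u^3 * (- 1) + k)"
        unfolding W weierstrass_eval.simps vertical_gap.simps by Groebner_Basis.algebra
      also have "\<dots> = u^6 * (weierstrass_eval W' x 1 - weierstrass_eval W' x (- 1))"
        unfolding iso' by (rule right_diff_distrib[symmetric])
      also have "weierstrass_eval W' x 1 - weierstrass_eval W' x (- 1) = 2 * vertical_gap W' x 0"
        by (simp add: W')
      also have "u^6 * (2 * vertical_gap W' x 0) = 2 * u^3 * (u^3 * vertical_gap W' x 0)"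
        by (simp flip: power_add)
      finally have gap: "vertical_gap W x' k = u^3 * vertical_gap W' x 0" using \<open>u \<noteq> 0\<close> by simp
      have "two_division W x' = (vertical_gap W x' k)^2 - 4 * weierstrass_eval W x' (u^3 * 0 + k)"
        by (simp add: vertical_gap_square)
      also have "\<dots> = u^6 * ((vertical_gap W' x 0)^2 - 4 * weierstrass_eval W' x 0)"
        unfolding iso' gap by Groebner_Basis.algebra
      also have "\<dots> = u^6 * two_division W' x" by (simp add: vertical_gap_square)
      finally show ?thesis by (simp add: x'_def)
    qed
    with \<open>u \<noteq> 0\<close> show "\<exists>u r. u \<noteq> 0 \<and> (\<forall>x. two_division W (u^2 * x + r) = u^6 * two_division W' x)"
      by blast
  next
    assume "\<exists>u r. u \<noteq> 0 \<and> (\<forall>x. two_division W (u^2 * x + r) = u^6 * two_division W' x)"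
    then obtain u r where "u \<noteq> 0"
      and g: "\<And>x. two_division W (u^2 * x + r) = u^6 * two_division W' x" by blast
    define s where "s = (u * c1 - a1) / 2"
    define t where "t = (u^3 * c3 - a1 * r - a3) / 2"
    have st: "2 * s = u * c1 - a1" "2 * t = u^3 * c3 - a1 * r - a3" by (simp_all add: s_def t_def)
    have "vertical_gap W (u^2 * x + r) (u^3 * y + u^2 * s * x + t)
        = 2 * u^3 * y + u^2 * x * (2 * s) + 2 * t + a1 * (u^2 * x + r) + a3" for x y
      unfolding W vertical_gap.simps by Groebner_Basis.algebra
    also have "\<dots> x y = u^3 * vertical_gap W' x y" for x y
      unfolding st W' vertical_gap.simps by Groebner_Basis.algebra
    finally have gap: "vertical_gap W (u^2 * x + r) (u^3 * y + u^2 * s * x + t)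
        = u^3 * vertical_gap W' x y" for x y .
    have "weierstrass_eval W (u^2 * x + r) (u^3 * y + u^2 * s * x + t) = u^6 * weierstrass_eval W' x y" for x y
      unfolding eval gap g by (simp add: field_simps flip: power_mult)
    with \<open>u \<noteq> 0\<close> show "isomorphic_over_rat W W'" unfolding isomorphic_over_rat_def by blast
  qed
qed

lemma two_division_model_curve:
  "two_division (model_curve r \<tau>) x
     = 4 * x * (x - of_int r) * (x - of_int r * (circle_cos \<tau>)^2)"
proof -
  define k where "k = of_int r * (circle_cos \<tau>)^2"
  have "model_curve r \<tau> = Weierstrass 0 (- (of_int r + k)) 0 (of_int r * k) 0"
    by (simp add: model_curve_def Let_def circle_cos_def k_def)
  then have "two_division (model_curve r \<tau>) x = 4 * x * (x - of_int r) * (x - k)"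
    by (simp add: algebra_simps power2_eq_square power3_eq_cube)
  then show ?thesis by (simp add: k_def)
qed

lemma elliptic_curve_model_curve:
  assumes "0 < r" "0 < \<tau>" "\<tau> < 1"
  shows "elliptic_curve (model_curve r \<tau>)"
proof -
  define k where "k = of_int r * (circle_cos \<tau>)^2"
  have "(circle_cos \<tau>)^2 < 1" using circle_cos_bounds[OF assms(2,3)] by (simp add: power_less_one_iff)
  then have "0 < k" "k < of_int r" using assms circle_cos_bounds[OF assms(2,3)] by (simp_all add: k_def)
  have "model_curve r \<tau> = Weierstrass 0 (- (of_int r + k)) 0 (of_int r * k) 0"
    by (simp add: model_curve_def Let_def circle_cos_def k_def)
  then have "discriminant (model_curve r \<tau>) = 16 * (of_int r)^2 * k^2 * (of_int r - k)^2"
    by (simp add: Let_def algebra_simps power2_eq_square power3_eq_cube)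
  then show ?thesis using \<open>0 < k\<close> \<open>k < _\<close> assms by (simp add: elliptic_curve_def)
qed

text \<open>
  The roots of $g$ for the model are $0 < r c^2 < r$ with $c$ = \<open>circle_cos \<tau>\<close>, and a change of
  variables moves them by $x \mapsto u^2 x + e$.
\<close>
lemma is_model_iff:
  assumes "0 < r" "0 < \<tau>" "\<tau> < 1"
  shows "is_model (model_curve r \<tau>) E \<longleftrightarrow>
    (\<exists>u e. u \<noteq> 0 \<and>
       splits_with_roots E e (e + u^2 * of_int r * (circle_cos \<tau>)^2) (e + u^2 * of_int r))"
proof -
  have "(\<forall>x. two_division E (u^2 * x + e) = u^6 * two_division (model_curve r \<tau>) x) \<longleftrightarrow>
      splits_with_roots E e (e + u^2 * of_int r * (circle_cos \<tau>)^2) (e + u^2 * of_int r)"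
    if "u \<noteq> 0" for u e
  proof -
    have model: "u^6 * two_division (model_curve r \<tau>) x
       = 4 * (u^2 * x + e - e) * (u^2 * x + e - (e + u^2 * of_int r * (circle_cos \<tau>)^2))
           * (u^2 * x + e - (e + u^2 * of_int r))" for x
      unfolding two_division_model_curve by Groebner_Basis.algebra
    show ?thesis
    proof
      assume *: "\<forall>x. two_division E (u^2 * x + e) = u^6 * two_division (model_curve r \<tau>) x"
      show "splits_with_roots E e (e + u^2 * of_int r * (circle_cos \<tau>)^2) (e + u^2 * of_int r)"
        unfolding splits_with_roots_def
      proof
        fix z
        have z: "z = u^2 * ((z - e) / u^2) + e" using that by simp
        show "two_division E z = 4 * (z - e) * (z - (e + u^2 * of_int r * (circle_cos \<tau>)^2))
            * (z - (e + u^2 * of_int r))"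
          using *[rule_format, of "(z - e) / u^2"] unfolding model z[symmetric] .
      qed
    qed (simp only: splits_with_roots_def model simp_thms)
  qed
  then show ?thesis
    unfolding is_model_def isomorphic_over_rat_iff
    using elliptic_curve_model_curve[OF assms] by blast
qed

lemma is_modelE:
  assumes "0 < r" "0 < \<tau>" "\<tau> < 1" "is_model (model_curve r \<tau>) E"
  obtains u e where "u \<noteq> 0"
    "splits_with_roots E e (e + u^2 * of_int r * (circle_cos \<tau>)^2) (e + u^2 * of_int r)"
    "e < e + u^2 * of_int r * (circle_cos \<tau>)^2"
    "e + u^2 * of_int r * (circle_cos \<tau>)^2 < e + u^2 * of_int r"
proof -
  obtain u e where ue: "u \<noteq> 0"
    "splits_with_roots E e (e + u^2 * of_int r * (circle_cos \<tau>)^2) (e + u^2 * of_int r)"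
    using assms(4) unfolding is_model_iff[OF assms(1-3)] by blast
  have "0 < u^2 * of_int r" using ue(1) assms(1) by simp
  moreover have "0 < (circle_cos \<tau>)^2" "(circle_cos \<tau>)^2 < 1"
    using circle_cos_bounds[OF assms(2,3)] by (simp_all add: power_less_one_iff)
  ultimately have "0 < u^2 * of_int r * (circle_cos \<tau>)^2"
    "u^2 * of_int r * (circle_cos \<tau>)^2 < u^2 * of_int r * 1"
    by (simp, intro mult_strict_left_mono) auto
  then show ?thesis using ue by (intro that[of u e]) simp_all
qed

text \<open>
  The ordered roots of $g$ determine $u^2 r$ and $c^2$. The squarefree class of the former is $r$,
  and $c$ determines $\tau$.
\<close>
lemma model_unique:
  assumes "0 < r" "squarefree r" "0 < \<tau>" "\<tau> < 1" "is_model (model_curve r \<tau>) E"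
    and "0 < r'" "squarefree r'" "0 < \<tau>'" "\<tau>' < 1" "is_model (model_curve r' \<tau>') E"
  shows "r = r' \<and> \<tau> = \<tau>'"
proof -
  obtain u e where u: "u \<noteq> 0"
    "splits_with_roots E e (e + u^2 * of_int r * (circle_cos \<tau>)^2) (e + u^2 * of_int r)"
    "e < e + u^2 * of_int r * (circle_cos \<tau>)^2"
    "e + u^2 * of_int r * (circle_cos \<tau>)^2 < e + u^2 * of_int r"
    using is_modelE[OF assms(1,3-5)] .
  obtain u' e' where u': "u' \<noteq> 0"
    "splits_with_roots E e' (e' + u'^2 * of_int r' * (circle_cos \<tau>')^2) (e' + u'^2 * of_int r')"
    "e' < e' + u'^2 * of_int r' * (circle_cos \<tau>')^2"
    "e' + u'^2 * of_int r' * (circle_cos \<tau>')^2 < e' + u'^2 * of_int r'"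
    using is_modelE[OF assms(6,8-10)] .
  note eq = splits_with_roots_unique[OF u(2-4) u'(2-4)]
  have R: "u^2 * of_int r = u'^2 * of_int r'" using eq(1,3) by simp
  have "r = r'"
    using squarefree_eq_if_quotient_square[OF assms(1,2,6,7) u(1) u'(1) R] .
  have "u^2 * of_int r * (circle_cos \<tau>)^2 = u^2 * of_int r * (circle_cos \<tau>')^2"
    using eq(1,2) R by simp
  then have "(circle_cos \<tau>)^2 = (circle_cos \<tau>')^2" using u(1) assms(1) by simp
  then have "circle_cos \<tau> = circle_cos \<tau>'"
    using circle_cos_bounds(1)[OF assms(3,4)] circle_cos_bounds(1)[OF assms(8,9)]
    by (simp add: power2_eq_iff)
  then have "\<tau> = \<tau>'" by (rule circle_cos_inject[OF assms(3,8)])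
  with \<open>r = r'\<close> show ?thesis by simp
qed

text \<open>
  With $R = u^2 r$ the outer roots have $g'/4 = (Rc)^2$ and $g'/4 = R^2 (1 - c^2)$, and $1 - c^2$
  is the square of the ordinate of the point of the circle.
\<close>
lemma card_square_two_torsion_of_model:
  assumes "0 < r" "0 < \<tau>" "\<tau> < 1" "is_model (model_curve r \<tau>) E"
  shows "card (square_two_torsion E) = 2"
proof -
  obtain u e where u: "u \<noteq> 0"
    "splits_with_roots E e (e + u^2 * of_int r * (circle_cos \<tau>)^2) (e + u^2 * of_int r)"
    "e < e + u^2 * of_int r * (circle_cos \<tau>)^2"
    "e + u^2 * of_int r * (circle_cos \<tau>)^2 < e + u^2 * of_int r"
    using is_modelE[OF assms] .
  define R where "R = u^2 * of_int r"
  define c where "c = circle_cos \<tau>"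
  have "(e + R * c^2 - e) * (e + R - e) = (R * c)^2" by (simp add: power2_eq_square)
  moreover have "(e + R - e) * (e + R - (e + R * c^2)) = R^2 * (1 - c^2)"
    by (simp add: algebra_simps power2_eq_square)
  then have "(e + R - e) * (e + R - (e + R * c^2)) = (R * (2 * \<tau> / (1 + \<tau>^2)))^2"
    by (simp only: c_def one_minus_circle_cos_square power_mult_distrib)
  ultimately have "square_two_torsion E = {e, e + R}"
    using u(2-4) unfolding R_def[symmetric] c_def[symmetric] by (intro square_two_torsion_of_split)
  moreover have "e \<noteq> e + R" using u(1) assms(1) by (simp add: R_def)
  ultimately show ?thesis by simp
qed

text \<open>
  Two roots at which $g'/4$ is a nonzero square must enclose the third root \<open>m\<close>. The two squares,
  divided by the square of the distance \<open>R\<close> of the outer roots, add up to 1.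
\<close>
lemma model_exists:
  assumes ell: "elliptic_curve E" and card: "card (square_two_torsion E) = 2"
  obtains r \<tau> where "0 < r" "squarefree r" "0 < \<tau>" "\<tau> < 1" "is_model (model_curve r \<tau>) E"
proof -
  obtain p q where "square_two_torsion E = {p, q}" "p < q"
    using card by (metis card_2_iff insert_commute linorder_neqE_linordered_idom)
  then have "p \<in> square_two_torsion E" "q \<in> square_two_torsion E" by simp_all
  then obtain s t where p: "two_division E p = 0" "s^2 = halving_square E p"
    and q: "two_division E q = 0" "t^2 = halving_square E q"
    by (auto simp: square_two_torsion_def)
  obtain m where "splits_with_roots E p q m"
    using splits_if_two_roots[OF p(1) q(1)] \<open>p < q\<close> by blast
  note split = this splits_with_roots_permute(1)[OF this]
  have hp: "halving_square E p = (p - q) * (p - m)" and hq: "halving_square E q = (q - p) * (q - m)"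
    using halving_square_at_root[OF split(1)] halving_square_at_root[OF split(2)] .
  have "s \<noteq> 0" "t \<noteq> 0" using elliptic_curve_no_double_root[OF ell] p q by auto
  then have "0 < (p - q) * (p - m)" "0 < (q - p) * (q - m)"
    using p(2) q(2) hp hq by (metis zero_less_power2)+
  then have "p < m" "m < q" using \<open>p < q\<close> by (simp_all add: zero_less_mult_iff)
  define R where "R = q - p"
  have "0 < R" using \<open>p < q\<close> by (simp add: R_def)
  have s2: "s^2 = R * (m - p)" using p(2) unfolding hp R_def by Groebner_Basis.algebra
  have t2: "t^2 = R * (q - m)" using q(2) unfolding hq R_def .
  define c where "c = \<bar>s\<bar> / R"
  define d where "d = \<bar>t\<bar> / R"
  have c2: "c^2 = (m - p) / R" and d2: "d^2 = (q - m) / R"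
    unfolding c_def d_def power_divide power2_abs s2 t2
    using \<open>0 < R\<close> by (simp_all add: power2_eq_square)
  have "c^2 + d^2 = (m - p + (q - m)) / R" unfolding c2 d2 by (rule add_divide_distrib[symmetric])
  also have "\<dots> = 1" using \<open>0 < R\<close> by (simp add: R_def)
  finally have "c^2 + d^2 = 1" .
  moreover have "0 < c" "0 < d" using \<open>s \<noteq> 0\<close> \<open>t \<noteq> 0\<close> \<open>0 < R\<close> by (simp_all add: c_def d_def)
  ultimately obtain \<tau> where \<tau>: "0 < \<tau>" "\<tau> < 1" "circle_cos \<tau> = c"
    using circle_point_is_circle_cos by metis
  obtain r u where r: "0 < r" "squarefree r" "u \<noteq> 0" "R = u^2 * of_int r"
    using squarefree_times_square_exists[OF \<open>0 < R\<close>] .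
  have "splits_with_roots E p m q"
    using split(1) by (simp add: splits_with_roots_def mult.assoc mult.commute)
  moreover have "p + R * c^2 = m" "p + R = q" using \<open>0 < R\<close> by (simp_all add: c2 R_def)
  ultimately have "splits_with_roots E p (p + u^2 * of_int r * (circle_cos \<tau>)^2) (p + u^2 * of_int r)"
    by (simp only: \<tau>(3) r(4)[symmetric])
  then have "is_model (model_curve r \<tau>) E"
    unfolding is_model_iff[OF r(1) \<tau>(1,2)] using r(3) by blast
  then show ?thesis by (rule that[OF r(1,2) \<tau>(1,2)])
qed

theorem proposition3p4:
  fixes E :: "rat weierstrass"
  assumes "elliptic_curve E"
  shows "card (stable_cyclic4_pairs E) = 2 \<longleftrightarrow>
         (\<exists>!(r, \<tau>). 0 < r \<and> squarefree r \<and> 0 < \<tau> \<and> \<tau> < 1 \<and> is_model (model_curve r \<tau>) E)"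
  unfolding card_stable_cyclic4_pairs[OF assms]
proof
  assume "card (square_two_torsion E) = 2"
  then obtain r \<tau> where "0 < r" "squarefree r" "0 < \<tau>" "\<tau> < 1" "is_model (model_curve r \<tau>) E"
    by (rule model_exists[OF assms])
  then show "\<exists>!(r, \<tau>). 0 < r \<and> squarefree r \<and> 0 < \<tau> \<and> \<tau> < 1 \<and> is_model (model_curve r \<tau>) E"
    by (intro ex1I[of _ "(r, \<tau>)"]) (auto dest: model_unique)
next
  assume "\<exists>!(r, \<tau>). 0 < r \<and> squarefree r \<and> 0 < \<tau> \<and> \<tau> < 1 \<and> is_model (model_curve r \<tau>) E"
  then obtain r \<tau> where "0 < r" "0 < \<tau>" "\<tau> < 1" "is_model (model_curve r \<tau>) E" by auto
  then show "card (square_two_torsion E) = 2" by (rule card_square_two_torsion_of_model)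
qed

end
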